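(* Suppose $W\in\mathcal R(\mathbb T)$, let $a\in\mathbb T$, and for any small $\varepsilon>0$ let the function $f_\varepsilon$ satisfy $$f_\varepsilon=\pi_Yf_\varepsilon\in L^2(\mathbb T),\qquad\|f_\varepsilon\|^2=1,\qquad Y=(a-\varepsilon,a+\varepsilon).$$ Then there exists the weak limit (as functionals on $C(\mathbb T)$, $\varphi\mapsto\frac1{2\pi}\int_{\mathbb T}\varphi\,|L_a*f_\varepsilon|^2dx$) $$\lim_{\varepsilon\searrow0}|L_a*f_\varepsilon|^2=\nu,\qquad\nu=\nu(x,a)=\sum_{m\in\mathbb Z}v_m(a)e^{im(x-a)} .$$ The limit is independent of the choice of the family $f_\varepsilon$ satisfying $f_\varepsilon=\pi_Yf_\varepsilon\in L^2(\mathbb T)$, $\|f_\varepsilon\|^2=1$, $Y=(a-\varepsilon,a+\varepsilon)$. For any $a\in\mathbb T$, $$d\widetilde\mu_{W,a}=\frac1{2\pi}\nu(x,a)\,dx$$ is a (non-negative) measure on $\mathbb T$, and its norm as a functional on $C(\mathbb T)$ satisfies $$\|\widetilde\mu_{W,a}\|_{C^*}=\int_{\mathbb T}d\widetilde\mu_{W,a}\le\|W\|_{\mathcal{DT}}^2 .$$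
   Context: $\mathbb T=\mathbb R/2\pi\mathbb Z$ with measure $d\mu=dx/2\pi$; $\|\cdot\|$ is the norm in $L^2(\mathbb T,\mu)$; $\pi_Y$ is multiplication by the indicator of $Y$. A bounded operator $W$ on $L^2(\mathbb T,\mu)$ has matrix $(W_{j,k})_{j,k\in\mathbb Z}$: $W\sum_kf_ke^{ikx}=\sum_{j,k}W_{j,k}f_ke^{ijx}$. $W\in\mathcal{DT}(\mathbb T)$ (diagonal type) means $c_k=\sup_j|W_{j+k,j}|<\infty$ for all $k\in\mathbb Z$ and $\|W\|_{\mathcal{DT}}:=\sum_{k\in\mathbb Z}c_k<\infty$. $W$ is regular ($W\in\mathcal R(\mathbb T)$) if $W\in\mathcal{DT}(\mathbb T)$ and for all $m,n\in\mathbb Z$ the limit $\omega_{m,n}=\lim_{\#I\to\infty}\frac1{\#I}\sum_{j\in\mathbb Z,\,l\in I}W_{l+m,j}\overline{W_{l,j+n}}$ exists, where $I\subset\mathbb Z$ ranges over finite intervals of consecutive integers (limit over all such intervals, irrespective of position, as $\#I\to\infty$). For $a\in\mathbb T$ put $w_j(a)=\sum_{k\in\mathbb Z}W_{j,k}e^{i(j-k)a}$ and $L_a=\sum_{j\in\mathbb Z}w_j(a)e^{ijx}$ (a distribution); convolution acts by $L_a*f=\sum_kw_k(a)f_ke^{ikx}$ for $f=\sum_kf_ke^{ikx}$. Further, $v_m(a)=\sum_{n\in\mathbb Z}\omega_{m,n}e^{i(m+n)a}$ (which equals $\lim_{\#I\to\infty}\frac1{\#I}\sum_{l\in I}w_{l+m}(a)\overline{w_l(a)}$).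 The series for $\nu(\cdot,a)$ is a Fourier series in $x$, understood in the sense of distributions, and $\frac1{2\pi}\nu(x,a)dx$ is the measure with Fourier coefficients $\int_{\mathbb T}e^{-imx}\,d\widetilde\mu_{W,a}=e^{-ima}v_m(a)$. *)

theory Defs
  imports "HOL-Analysis.Analysis"
begin

text \<open>
  Functions on the circle \<open>R / 2 pi Z\<close> are \<open>2 pi\<close>-periodic functions on the real line, and points
  of the circle are real numbers (every notion below is \<open>2 pi\<close>-periodic in the point).
  Borel measures on the circle are Borel measures on the real line that are concentrated on the
  fundamental domain \<open>[0, 2 pi)\<close>.
\<close>

definition periodic :: "(real \<Rightarrow> complex) \<Rightarrow> bool" where
  "periodic f \<longleftrightarrow> (\<forall>x. f (x + 2 * pi) = f x)"

definition circle_measure :: "real measure \<Rightarrow> bool" where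
  "circle_measure M \<longleftrightarrow> sets M = sets borel \<and> finite_measure M \<and> emeasure M (- {0..<2 * pi}) = 0"

definition mu :: "real measure" where
  "mu = uniform_measure lborel {0..<2 * pi}"

definition arc :: "real \<Rightarrow> real \<Rightarrow> real set" where
  "arc a r = {x. \<exists>k::int. \<bar>x - a - 2 * pi * of_int k\<bar> < r}"

definition circle_cont :: "(real \<Rightarrow> complex) set" where
  "circle_cont = {\<phi>. periodic \<phi> \<and> continuous_on UNIV \<phi>}"

definition circle_smooth :: "(real \<Rightarrow> complex) set" where
  "circle_smooth = {\<phi>. periodic \<phi> \<and>
     (\<exists>D. D 0 = \<phi> \<and> (\<forall>n x. (D n has_vector_derivative D (Suc n) x) (at x)))}"

text \<open>
  Elements of \<open>L2\<close> are represented by Borel functions; equality in the Hilbert space is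
  equality almost everywhere.
\<close>

definition L2 :: "(real \<Rightarrow> complex) set" where
  "L2 = {f. periodic f \<and> f \<in> borel_measurable borel \<and> integrable mu (\<lambda>x. (cmod (f x))\<^sup>2)}"

definition L2_norm :: "(real \<Rightarrow> complex) \<Rightarrow> real" where
  "L2_norm f = sqrt (\<integral>x. (cmod (f x))\<^sup>2 \<partial>mu)"

definition e :: "int \<Rightarrow> real \<Rightarrow> complex" where
  "e k x = cis (of_int k * x)"

definition fourier_coeff :: "(real \<Rightarrow> complex) \<Rightarrow> int \<Rightarrow> complex" where
  "fourier_coeff f k = (\<integral>x. e (- k) x * f x \<partial>mu)"

definition restr :: "real set \<Rightarrow> (real \<Rightarrow> complex) \<Rightarrow> real \<Rightarrow> complex" where
  "restr Y f = (\<lambda>x. indicator Y x * f x)"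

text \<open>
  Boundedness together with linearity forces \<open>W\<close> to respect equality almost everywhere, so that
  it does act on the Hilbert space.
\<close>

definition bounded_operator :: "((real \<Rightarrow> complex) \<Rightarrow> (real \<Rightarrow> complex)) \<Rightarrow> bool" where
  "bounded_operator W \<longleftrightarrow>
     (\<forall>f\<in>L2. W f \<in> L2) \<and>
     (\<forall>f\<in>L2. \<forall>g\<in>L2. AE x in mu. W (\<lambda>y. f y + g y) x = W f x + W g x) \<and>
     (\<forall>f\<in>L2. \<forall>c. AE x in mu. W (\<lambda>y. c * f y) x = c * W f x) \<and>
     (\<exists>C. \<forall>f\<in>L2. L2_norm (W f) \<le> C * L2_norm f)"

definition op_mat :: "((real \<Rightarrow> complex) \<Rightarrow> (real \<Rightarrow> complex)) \<Rightarrow> int \<Rightarrow> int \<Rightarrow> complex" where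
  "op_mat W j k = fourier_coeff (W (e k)) j"

definition DT_coeff :: "((real \<Rightarrow> complex) \<Rightarrow> (real \<Rightarrow> complex)) \<Rightarrow> int \<Rightarrow> real" where
  "DT_coeff W k = (SUP j. cmod (op_mat W (j + k) j))"

definition diagonal_type :: "((real \<Rightarrow> complex) \<Rightarrow> (real \<Rightarrow> complex)) \<Rightarrow> bool" where
  "diagonal_type W \<longleftrightarrow> bounded_operator W \<and>
     (\<forall>k. bdd_above (range (\<lambda>j. cmod (op_mat W (j + k) j)))) \<and>
     DT_coeff W summable_on UNIV"

definition DT_norm :: "((real \<Rightarrow> complex) \<Rightarrow> (real \<Rightarrow> complex)) \<Rightarrow> real" where
  "DT_norm W = (\<Sum>\<^sub>\<infinity>k. DT_coeff W k)"

text \<open>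
  The filter of \<open>#I \<rightarrow> \<infinity>\<close>, where \<open>I\<close> ranges over the finite intervals of
  consecutive integers, irrespective of their position.
\<close>

definition long_intervals :: "int set filter" where
  "long_intervals = inf (filtercomap card at_top) (principal {I. \<exists>p q. I = {p..q}})"

definition corr_avg ::
    "((real \<Rightarrow> complex) \<Rightarrow> (real \<Rightarrow> complex)) \<Rightarrow> int \<Rightarrow> int \<Rightarrow> int set \<Rightarrow> complex" where
  "corr_avg W m n I =
     (\<Sum>l\<in>I. \<Sum>\<^sub>\<infinity>j. op_mat W (l + m) j * cnj (op_mat W l (j + n))) / of_nat (card I)"

definition regular_operator :: "((real \<Rightarrow> complex) \<Rightarrow> (real \<Rightarrow> complex)) \<Rightarrow> bool" where
  "regular_operator W \<longleftrightarrow> diagonal_type W \<and>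
     (\<forall>m n. \<exists>L. (corr_avg W m n \<longlongrightarrow> L) long_intervals)"

definition omega :: "((real \<Rightarrow> complex) \<Rightarrow> (real \<Rightarrow> complex)) \<Rightarrow> int \<Rightarrow> int \<Rightarrow> complex" where
  "omega W m n = Lim long_intervals (corr_avg W m n)"

definition w_coeff :: "((real \<Rightarrow> complex) \<Rightarrow> (real \<Rightarrow> complex)) \<Rightarrow> int \<Rightarrow> real \<Rightarrow> complex" where
  "w_coeff W j a = (\<Sum>\<^sub>\<infinity>k. op_mat W j k * e (j - k) a)"

definition v_coeff :: "((real \<Rightarrow> complex) \<Rightarrow> (real \<Rightarrow> complex)) \<Rightarrow> int \<Rightarrow> real \<Rightarrow> complex" where
  "v_coeff W m a = (\<Sum>\<^sub>\<infinity>n. omega W m n * e (m + n) a)"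

definition L2_fourier_series :: "(int \<Rightarrow> complex) \<Rightarrow> (real \<Rightarrow> complex) \<Rightarrow> bool" where
  "L2_fourier_series c g \<longleftrightarrow> g \<in> L2 \<and>
     (\<lambda>N. L2_norm (\<lambda>x. g x - (\<Sum>k\<in>{- int N..int N}. c k * e k x))) \<longlonglongrightarrow> 0"

text \<open>
  The convolution \<open>L_a * f\<close>, where \<open>L_a\<close> is the distribution with Fourier coefficients
  \<open>w_coeff W k a\<close>. For \<open>W\<close> of diagonal type these are bounded in \<open>k\<close>, so for \<open>f\<close> in \<open>L2\<close> the series
  converges in \<open>L2\<close>, and its sum is unique up to a null set.
\<close>

definition L_conv ::
    "((real \<Rightarrow> complex) \<Rightarrow> (real \<Rightarrow> complex)) \<Rightarrow> real \<Rightarrow> (real \<Rightarrow> complex) \<Rightarrow> real \<Rightarrow> complex" where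
  "L_conv W a f = (SOME g. L2_fourier_series (\<lambda>k. w_coeff W k a * fourier_coeff f k) g)"

text \<open>
  \<open>M\<close> is \<open>(1 / 2 pi) \<nu>(x, a) dx\<close>, where the series for \<open>\<nu>\<close> is summed in the sense
  of distributions, that is, after pairing each term with a smooth test function.
\<close>

definition is_nu :: "((real \<Rightarrow> complex) \<Rightarrow> (real \<Rightarrow> complex)) \<Rightarrow> real \<Rightarrow> real measure \<Rightarrow> bool" where
  "is_nu W a M \<longleftrightarrow> (\<forall>\<phi>\<in>circle_smooth.
     ((\<lambda>m. \<integral>x. \<phi> x * (v_coeff W m a * e m (x - a)) \<partial>mu) has_sum (\<integral>x. \<phi> x \<partial>M)) UNIV)"

text \<open>
  Admissible families: the conditions are imposed for all sufficiently small positive \<open>\<epsilon>\<close>.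
\<close>

definition concentrating :: "real \<Rightarrow> (real \<Rightarrow> real \<Rightarrow> complex) \<Rightarrow> bool" where
  "concentrating a f \<longleftrightarrow> (\<forall>\<^sub>F \<epsilon> in at_right 0.
     f \<epsilon> \<in> L2 \<and> (AE x in mu. f \<epsilon> x = restr (arc a \<epsilon>) (f \<epsilon>) x) \<and> (L2_norm (f \<epsilon>))\<^sup>2 = 1)"

text \<open>The norm of a functional on the continuous functions with the supremum norm.\<close>

definition C_dual_norm :: "((real \<Rightarrow> complex) \<Rightarrow> complex) \<Rightarrow> ennreal" where
  "C_dual_norm F = (SUP \<phi>\<in>{\<phi>\<in>circle_cont. \<forall>x. cmod (\<phi> x) \<le> 1}. ennreal (cmod (F \<phi>)))"

end

theory Submission
  imports Defs "HOL-Probability.Helly_Selection"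
begin

text \<open>
  Write \<open>w\<^sub>k\<close> for \<open>w_coeff W k a\<close> and \<open>p\<^sub>k\<close> for the Fourier coefficients of a unit vector \<open>f\<close> supported
  in the arc of radius \<open>\<epsilon>\<close> around \<open>a\<close>. By Parseval, the Fourier coefficient of
  \<open>\<bar>L\<^sub>a * f\<bar>\<^sup>2\<close> at \<open>m\<close> is the sum over \<open>k\<close> of \<open>w\<^sub>k\<^sub>+\<^sub>m cnj w\<^sub>k p\<^sub>k\<^sub>+\<^sub>m cnj p\<^sub>k\<close>.

  Concentration of \<open>f\<close> enters only through the sequence \<open>p\<close>. The shifted sequence \<open>p\<^sub>k\<^sub>+\<^sub>m\<close> consists of
  the coefficients of \<open>e (- m) f\<close>, and on the support of \<open>f\<close> the character differs from its value
  at \<open>a\<close> by at most \<open>\<bar>m\<bar> \<epsilon>\<close>; so by Bessel \<open>p\<^sub>k\<^sub>+\<^sub>m\<close> is \<open>e (- m) a p\<^sub>k\<close> up to an error of size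
  \<open>\<bar>m\<bar> \<epsilon>\<close> in the space of square-summable sequences. Two things follow. The coefficient at \<open>m\<close> is
  close to \<open>e (- m) a\<close> times the mean of \<open>w\<^sub>k\<^sub>+\<^sub>m cnj w\<^sub>k\<close> with respect to the probability weights
  \<open>\<bar>p\<^sub>k\<bar>\<^sup>2\<close>. Moreover these weights hardly change under a shift by \<open>j\<close>, for all \<open>j\<close> below a fixed \<open>N\<close>,
  so that \<open>w\<^sub>k\<^sub>+\<^sub>m cnj w\<^sub>k\<close> may be replaced by its averages over windows of length \<open>N\<close>. Regularity
  of \<open>W\<close> says that these averages converge, uniformly in the position of the window: expanding the
  product as a double series gives, for each window, a series in \<open>n\<close> of the averages whose limits are
  \<open>omega W m n\<close>, dominated by the summable autocorrelation of \<open>DT_coeff W\<close>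
  (\<open>w_coeff_product_mean\<close>). Hence the coefficient at \<open>m\<close> tends to \<open>e (- m) a v_coeff W m a\<close>
  (\<open>concentrating_coeff_tendsto\<close>), whatever the family \<open>f\<close> is.

  The limits are the Fourier coefficients of a measure because they are limits of Fourier coefficients
  of non-negative densities: normalised indicators of arcs form an admissible family, and the
  selection theorem of Helly provides a weakly convergent subsequence of the resulting measures
  (\<open>measure_of_limit_coefficients\<close>). Convergence of all coefficients, together with the density of
  trigonometric polynomials in the continuous functions, is weak convergence
  (\<open>weak_convergence_of_coefficients\<close>). The bound on the mass is the bound
  \<open>\<bar>w\<^sub>k\<bar> \<le> DT_norm W\<close> passed through the mean value. Finally, a smooth function has an
  absolutely convergent Fourier series, and pairing it with the measure term by term is the
  distributional form of the series for \<open>\<nu>\<close> (\<open>is_nu_of_coefficients\<close>).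

  Two facts about \<open>L2\<close> underlie all this: the theorem of Riesz and Fischer, by which \<open>L_conv\<close> is the
  sum of its series, and the completeness of the characters, by which the weights \<open>\<bar>p\<^sub>k\<bar>\<^sup>2\<close> sum to one.
\<close>

section \<open>Normalised Lebesgue measure and the characters of the circle\<close>

lemma prob_space_mu: "prob_space mu"
  unfolding mu_def by (rule prob_space_uniform_measure) auto

interpretation mu: prob_space mu
  by (rule prob_space_mu)

lemma sets_mu [simp, measurable_cong]: "sets mu = sets borel"
  by (simp add: mu_def)

lemma space_mu [simp]: "space mu = UNIV"
  by (simp add: mu_def)

lemma AE_mu_iff: "(AE x in mu. P x) \<longleftrightarrow> (AE x in lborel. x \<in> {0..<2*pi} \<longrightarrow> P x)"
  unfolding mu_def by (subst AE_uniform_measure) auto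

lemma AE_mu_fundamental: "AE x in mu. x \<in> {0..<2*pi}"
  by (simp add: AE_mu_iff)

lemma mu_eq_density: "mu = density lborel (\<lambda>x. ennreal (indicator {0..<2*pi} x / (2*pi)))"
proof -
  have "indicator {0..<2*pi} x / ennreal (2*pi) = ennreal (indicator {0..<2*pi} x / (2*pi))" for x
    by (auto simp: indicator_def divide_ennreal simp flip: ennreal_1)
  then show ?thesis by (simp add: mu_def uniform_measure_def)
qed

lemma integral_mu:
  fixes f :: "real \<Rightarrow> complex"
  assumes [measurable]: "f \<in> borel_measurable borel"
  shows "(\<integral>x. f x \<partial>mu) = (\<integral>x\<in>{0..2*pi}. f x \<partial>lborel) / (2*pi)"
proof -
  have "(\<integral>x. f x \<partial>mu) = (\<integral>x. (indicator {0..<2*pi} x / (2*pi)) *\<^sub>R f x \<partial>lborel)"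
    unfolding mu_eq_density by (subst integral_density) auto
  also have "\<dots> = (\<integral>x. (indicator {0..2*pi} x *\<^sub>R f x) / (2*pi) \<partial>lborel)"
  proof (rule integral_cong_AE)
    have "AE x in lborel. x \<noteq> 2*pi" by (rule AE_lborel_singleton)
    then show "AE x in lborel. (indicator {0..<2*pi} x / (2*pi)) *\<^sub>R f x = (indicator {0..2*pi} x *\<^sub>R f x) / (2*pi)"
      by eventually_elim (auto simp: indicator_def scaleR_conv_of_real)
  qed auto
  also have "\<dots> = (\<integral>x\<in>{0..2*pi}. f x \<partial>lborel) / (2*pi)"
    by (simp add: set_lebesgue_integral_def)
  finally show ?thesis .
qed

text \<open>
  The fundamental theorem of calculus on the circle. For a periodic antiderivative the right-hand
  side vanishes, which yields both the orthogonality of the characters and integration by parts.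
\<close>

lemma integral_mu_antiderivative:
  fixes F f :: "real \<Rightarrow> complex"
  assumes d: "\<And>x. (F has_vector_derivative f x) (at x)" and c: "continuous_on UNIV f"
  shows "(\<integral>x. f x \<partial>mu) = (F (2*pi) - F 0) / (2*pi)"
proof -
  have "has_bochner_integral lborel (\<lambda>x. indicator {0..2*pi} x *\<^sub>R f x) (F (2*pi) - F 0)"
    using d by (intro has_bochner_integral_FTC_Icc) (auto intro: has_vector_derivative_at_within continuous_on_subset[OF c])
  then have "(\<integral>x\<in>{0..2*pi}. f x \<partial>lborel) = F (2*pi) - F 0"
    unfolding set_lebesgue_integral_def by (rule has_bochner_integral_integral_eq)
  moreover have "f \<in> borel_measurable borel"
    by (rule borel_measurable_continuous_onI[OF c])
  ultimately show ?thesis by (simp add: integral_mu)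
qed

lemma e_add: "e j x * e k x = e (j + k) x"
  by (simp add: e_def cis_mult algebra_simps)

lemma e_0 [simp]: "e 0 x = 1"
  by (simp add: e_def)

lemma cmod_e [simp]: "cmod (e k x) = 1"
  by (simp add: e_def)

lemma cnj_e: "cnj (e k x) = e (- k) x"
  by (simp add: e_def cis_cnj)

lemma e_diff: "e k (x - y) = e k x * e (- k) y"
  by (simp add: e_def cis_mult algebra_simps)

lemma continuous_on_e [continuous_intros]: "continuous_on A (e k)"
  unfolding e_def by (intro continuous_intros)

lemma isCont_e: "isCont (e k) x"
  using continuous_on_e[of UNIV k] by (simp add: continuous_on_eq_continuous_at)

lemma measurable_e [measurable]: "e k \<in> borel_measurable borel"
  by (rule borel_measurable_continuous_onI[OF continuous_on_e])

lemma cis_2pi_int: "cis (2 * pi * of_int k) = 1"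
  using cis_multiple_2pi[of "of_int k"] by (simp add: mult_ac)

lemma e_periodic: "e k (x + 2*pi) = e k x"
proof -
  have "e k (x + 2*pi) = e k x * cis (2 * pi * of_int k)"
    by (simp add: e_def cis_mult algebra_simps)
  then show ?thesis by (simp only: cis_2pi_int mult_1_right)
qed

lemma periodic_e: "periodic (e k)"
  by (simp add: periodic_def e_periodic)

lemma e_derivative: "(e k has_vector_derivative (\<i> * of_int k * e k x)) (at x)"
proof -
  have "((\<lambda>x. exp (\<i> * of_int k * of_real x)) has_vector_derivative (\<i> * of_int k * exp (\<i> * of_int k * of_real x))) (at x)"
    by (rule has_vector_derivative_real_field) (auto intro!: derivative_eq_intros)
  then show ?thesis
    by (simp add: e_def[abs_def] cis_conv_exp mult.assoc)
qed

lemma integral_e_mu: "(\<integral>x. e k x \<partial>mu) = of_bool (k = 0)"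
proof (cases "k = 0")
  case True
  then show ?thesis using mu.prob_space by simp
next
  case False
  define F where "F x = e k x / (\<i> * of_int k)" for x
  have "(F has_vector_derivative e k x) (at x)" for x
  proof -
    have "(F has_vector_derivative (\<i> * of_int k * e k x) / (\<i> * of_int k)) (at x)"
      unfolding F_def by (intro has_vector_derivative_divide e_derivative)
    then show ?thesis using False by simp
  qed
  then have "(\<integral>x. e k x \<partial>mu) = (F (2*pi) - F 0) / (2*pi)"
    by (intro integral_mu_antiderivative continuous_on_e)
  also have "F (2*pi) = F 0"
    using e_periodic[of k 0] by (simp add: F_def)
  finally show ?thesis using False by simp
qed

section \<open>Density of trigonometric polynomials\<close>

inductive_set trig_poly :: "(real \<Rightarrow> complex) set" where
  monomial: "(\<lambda>x. c * e k x) \<in> trig_poly"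
| add: "p \<in> trig_poly \<Longrightarrow> q \<in> trig_poly \<Longrightarrow> (\<lambda>x. p x + q x) \<in> trig_poly"

lemma trig_poly_const: "(\<lambda>x. c) \<in> trig_poly"
  using trig_poly.monomial[of c 0] by simp

lemma trig_poly_monomial_mult: "p \<in> trig_poly \<Longrightarrow> (\<lambda>x. (c * e k x) * p x) \<in> trig_poly"
proof (induction rule: trig_poly.induct)
  case (monomial d l)
  have "(\<lambda>x. c * e k x * (d * e l x)) = (\<lambda>x. (c * d) * e (k + l) x)"
    by (simp add: fun_eq_iff e_add[symmetric])
  then show ?case using trig_poly.monomial by simp
next
  case (add p q)
  then show ?case by (simp add: distrib_left trig_poly.add)
qed

lemma trig_poly_mult: "p \<in> trig_poly \<Longrightarrow> q \<in> trig_poly \<Longrightarrow> (\<lambda>x. p x * q x) \<in> trig_poly"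
proof (induction rule: trig_poly.induct)
  case (monomial c k)
  then show ?case by (rule trig_poly_monomial_mult)
next
  case (add p q)
  then show ?case by (simp add: distrib_right trig_poly.add)
qed

lemma trig_poly_cos: "(\<lambda>x. complex_of_real (cos x)) \<in> trig_poly"
proof -
  have "(\<lambda>x. complex_of_real (cos x)) = (\<lambda>x. (1/2) * e 1 x + (1/2) * e (-1) x)"
    by (auto simp: fun_eq_iff e_def complex_eq_iff)
  then show ?thesis by (simp only: trig_poly.intros)
qed

lemma trig_poly_sin: "(\<lambda>x. complex_of_real (sin x)) \<in> trig_poly"
proof -
  have "(\<lambda>x. complex_of_real (sin x)) = (\<lambda>x. (-\<i>/2) * e 1 x + (\<i>/2) * e (-1) x)"
    by (auto simp: fun_eq_iff e_def complex_eq_iff)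
  then show ?thesis by (simp only: trig_poly.intros)
qed

text \<open>
  Real and imaginary part of \<open>cis x\<close> are \<open>cos x\<close> and \<open>sin x\<close>, so a polynomial in the two real
  coordinates of the plane restricts to a trigonometric polynomial on the unit circle.
\<close>

lemma trig_poly_of_real_polynomial:
  "real_polynomial_function q \<Longrightarrow> (\<lambda>x. complex_of_real (q (cis x))) \<in> trig_poly"
proof (induction q rule: real_polynomial_function.induct)
  case (linear q)
  interpret bounded_linear q by fact
  have "q (cis x) = q 1 * cos x + q \<i> * sin x" for x
  proof -
    have "cis x = cos x *\<^sub>R 1 + sin x *\<^sub>R \<i>"
      by (simp add: complex_eq_iff)
    then show ?thesis by (simp only: add scale) simp
  qed
  then have "(\<lambda>x. complex_of_real (q (cis x))) = (\<lambda>x. complex_of_real (q 1) * complex_of_real (cos x) + complex_of_real (q \<i>) * complex_of_real (sin x))"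
    by (simp only: of_real_add of_real_mult)
  then show ?case
    using trig_poly.add[OF trig_poly_mult[OF trig_poly_const trig_poly_cos] trig_poly_mult[OF trig_poly_const trig_poly_sin]]
    by simp
next
  case (const c)
  then show ?case by (rule trig_poly_const)
next
  case (add f g)
  then show ?case by (simp add: trig_poly.add)
next
  case (mult f g)
  then show ?case by (simp add: trig_poly_mult)
qed

lemma periodic_shift_int: "periodic f \<Longrightarrow> f (x + 2*pi * of_int k) = f x"
proof -
  assume p: "periodic f"
  have n: "f (y + 2*pi * real n) = f y" for n y
  proof (induction n)
    case (Suc n)
    have "f (y + 2*pi * real (Suc n)) = f ((y + 2*pi * real n) + 2*pi)"
      by (simp add: algebra_simps)
    then show ?case using p Suc by (simp add: periodic_def)
  qed simp
  show ?thesis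
  proof (cases k)
    case (nonneg n)
    then show ?thesis using n[of x n] by simp
  next
    case (neg n)
    have "x + 2*pi * of_int k = x - 2*pi * real (Suc n)"
      unfolding neg by (simp add: algebra_simps)
    moreover have "f (x - 2*pi * real (Suc n)) = f x"
      using n[of "x - 2*pi * real (Suc n)" "Suc n"] by simp
    ultimately show ?thesis by (simp only:)
  qed
qed

lemma periodic_cis_eq:
  assumes "periodic f" "cis x = cis y" shows "f x = f y"
proof -
  have "sin x = sin y \<and> cos x = cos y"
    using assms(2) by (simp add: complex_eq_iff)
  then obtain n :: int where "x = y + 2*pi * of_int n"
    by (auto simp: sin_cos_eq_iff mult_ac)
  then show ?thesis using periodic_shift_int[OF assms(1)] by simp
qed

text \<open>
  A periodic function factors through \<open>cis\<close>. The principal argument jumps only across the negative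
  real axis, where by periodicity it may be exchanged for the argument with values in \<open>[0, 2 pi)\<close>.
\<close>

lemma circle_cont_lift_continuous:
  assumes "\<phi> \<in> circle_cont"
  shows "continuous_on (sphere 0 1) (\<lambda>z. \<phi> (Arg z))"
proof -
  have per: "periodic \<phi>" and cont: "\<And>x. isCont \<phi> x"
    using assms by (auto simp: circle_cont_def continuous_on_eq_continuous_at)
  have Arg: "cis (Arg z) = z" and Arg2: "cis (Arg2pi z) = z" if "z \<in> sphere 0 1" for z
  proof -
    have "z \<noteq> 0" using that by auto
    then show "cis (Arg z) = z" "cis (Arg2pi z) = z"
      using that cis_Arg[of z] Arg2pi_eq[of z] by (auto simp: sgn_div_norm cis_conv_exp)
  qed
  show ?thesis
    unfolding continuous_on_eq_continuous_within
  proof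
    fix z :: complex assume z: "z \<in> sphere 0 1"
    show "continuous (at z within sphere 0 1) (\<lambda>z. \<phi> (Arg z))"
    proof (cases "z \<in> \<real>\<^sub>\<le>\<^sub>0")
      case False
      have "isCont (\<lambda>z. \<phi> (Arg z)) z"
        using isCont_o2[OF continuous_at_Arg[OF False] cont] by simp
      then show ?thesis by (rule continuous_at_imp_continuous_within)
    next
      case True
      then have "z \<notin> \<real>\<^sub>\<ge>\<^sub>0" using z
        by (auto simp: complex_nonpos_Reals_iff complex_nonneg_Reals_iff) (auto simp: cmod_def)
      then have "isCont (\<lambda>z. \<phi> (Arg2pi z)) z"
        using isCont_o2[OF continuous_at_Arg2pi cont] by simp
      then have "continuous (at z within sphere 0 1) (\<lambda>z. \<phi> (Arg2pi z))"
        by (rule continuous_at_imp_continuous_within)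
      moreover have "\<phi> (Arg2pi w) = \<phi> (Arg w)" if "w \<in> sphere 0 1" for w
        using that Arg Arg2 by (intro periodic_cis_eq[OF per]) simp
      ultimately show ?thesis
        using z by (elim continuous_transform_within[where \<delta>=1]) auto
    qed
  qed
qed

text \<open>
  The Stone--Weierstrass theorem on the unit circle, regarded as a compact subset of the plane.
\<close>

lemma trig_poly_dense:
  assumes "\<phi> \<in> circle_cont" "\<delta> > 0"
  obtains p where "p \<in> trig_poly" "\<And>x. cmod (\<phi> x - p x) < \<delta>"
proof -
  obtain g where g: "polynomial_function g" "\<And>z. z \<in> sphere 0 1 \<Longrightarrow> cmod (\<phi> (Arg z) - g z) < \<delta>"
    using Stone_Weierstrass_polynomial_function[OF compact_sphere circle_cont_lift_continuous[OF assms(1)] assms(2)]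
    by blast
  have "real_polynomial_function (\<lambda>z. Re (g z))" "real_polynomial_function (\<lambda>z. Im (g z))"
    using g(1) bounded_linear_Re bounded_linear_Im by (auto simp: polynomial_function_def o_def)
  then have "(\<lambda>x. complex_of_real (Re (g (cis x))) + \<i> * complex_of_real (Im (g (cis x)))) \<in> trig_poly"
    by (intro trig_poly.add trig_poly_mult trig_poly_const trig_poly_of_real_polynomial)
  then have "(\<lambda>x. g (cis x)) \<in> trig_poly"
    by (simp flip: complex_eq)
  moreover have "cmod (\<phi> x - g (cis x)) < \<delta>" for x
  proof -
    have "cis (Arg (cis x)) = cis x"
      using cis_Arg[of "cis x"] by (simp add: sgn_div_norm)
    moreover have "periodic \<phi>"
      using assms(1) by (simp add: circle_cont_def)
    ultimately have "\<phi> (Arg (cis x)) = \<phi> x"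
      by (rule periodic_cis_eq[rotated])
    then show ?thesis using g(2)[of "cis x"] by simp
  qed
  ultimately show ?thesis by (rule that)
qed

section \<open>Square-integrable functions and the Bessel inequality\<close>

lemma L2_periodic: "f \<in> L2 \<Longrightarrow> periodic f"
  and L2_measurable: "f \<in> L2 \<Longrightarrow> f \<in> borel_measurable borel"
  and L2_integrable_square: "f \<in> L2 \<Longrightarrow> integrable mu (\<lambda>x. (cmod (f x))\<^sup>2)"
  by (auto simp: L2_def)

lemma measurable_cnj [measurable]: "cnj \<in> borel_measurable borel"
  by (rule borel_measurable_continuous_onI) (intro continuous_intros)

lemma L2_norm_square: "(L2_norm f)\<^sup>2 = (\<integral>x. (cmod (f x))\<^sup>2 \<partial>mu)"
  by (simp add: L2_norm_def)

lemma L2_integrable_norm_mult: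
  assumes "f \<in> L2" "g \<in> L2"
  shows "integrable mu (\<lambda>x. cmod (f x) * cmod (g x))"
proof (rule Bochner_Integration.integrable_bound)
  note [measurable] = assms[THEN L2_measurable]
  show "integrable mu (\<lambda>x. (cmod (f x))\<^sup>2 + (cmod (g x))\<^sup>2)"
    using assms by (intro Bochner_Integration.integrable_add L2_integrable_square)
  show "(\<lambda>x. cmod (f x) * cmod (g x)) \<in> borel_measurable mu" by measurable
  have "cmod (f x) * cmod (g x) \<le> (cmod (f x))\<^sup>2 + (cmod (g x))\<^sup>2" for x
  proof -
    have "0 \<le> cmod (f x) * cmod (g x)" by simp
    then show ?thesis
      using sum_squares_bound[of "cmod (f x)" "cmod (g x)"] by linarith
  qed
  then show "AE x in mu. norm (cmod (f x) * cmod (g x)) \<le> norm ((cmod (f x))\<^sup>2 + (cmod (g x))\<^sup>2)"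
    by simp
qed

lemma L2_integrable_inner:
  assumes "f \<in> L2" "g \<in> L2"
  shows "integrable mu (\<lambda>x. f x * cnj (g x))"
proof (rule Bochner_Integration.integrable_bound[OF L2_integrable_norm_mult[OF assms]])
  note [measurable] = assms[THEN L2_measurable]
  show "(\<lambda>x. f x * cnj (g x)) \<in> borel_measurable mu" by measurable
qed (simp add: norm_mult)

lemma e_in_L2: "e k \<in> L2"
  by (simp add: L2_def periodic_e)

lemma L2_integrable: "f \<in> L2 \<Longrightarrow> integrable mu f"
  using L2_integrable_inner[OF _ e_in_L2[of 0]] by simp

lemma L2_add:
  assumes "f \<in> L2" "g \<in> L2" shows "(\<lambda>x. f x + g x) \<in> L2"
proof -
  note [measurable] = assms[THEN L2_measurable]
  have "integrable mu (\<lambda>x. (cmod (f x + g x))\<^sup>2)"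
  proof (rule Bochner_Integration.integrable_bound)
    show "integrable mu (\<lambda>x. 2 * (cmod (f x))\<^sup>2 + 2 * (cmod (g x))\<^sup>2)"
      using assms by (intro Bochner_Integration.integrable_add integrable_mult_right L2_integrable_square)
    have "(cmod (f x + g x))\<^sup>2 \<le> 2 * (cmod (f x))\<^sup>2 + 2 * (cmod (g x))\<^sup>2" for x
    proof -
      have "(cmod (f x + g x))\<^sup>2 \<le> (cmod (f x) + cmod (g x))\<^sup>2"
        by (intro power_mono norm_triangle_ineq) auto
      also have "\<dots> \<le> 2 * (cmod (f x))\<^sup>2 + 2 * (cmod (g x))\<^sup>2"
        using sum_squares_bound[of "cmod (f x)" "cmod (g x)"] by (simp add: power2_sum)
      finally show ?thesis .
    qed
    then show "AE x in mu. norm ((cmod (f x + g x))\<^sup>2) \<le> norm (2 * (cmod (f x))\<^sup>2 + 2 * (cmod (g x))\<^sup>2)"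
      by simp
  qed measurable
  then show ?thesis
    using assms by (simp add: L2_def periodic_def)
qed

lemma L2_mult_bounded:
  assumes f: "f \<in> L2" and h: "periodic h" "h \<in> borel_measurable borel" "\<And>x. cmod (h x) \<le> B"
  shows "(\<lambda>x. h x * f x) \<in> L2"
proof -
  note [measurable] = L2_measurable[OF f] h(2)
  have "integrable mu (\<lambda>x. (cmod (h x * f x))\<^sup>2)"
  proof (rule Bochner_Integration.integrable_bound)
    show "integrable mu (\<lambda>x. B\<^sup>2 * (cmod (f x))\<^sup>2)"
      using f by (intro integrable_mult_right L2_integrable_square)
    show "AE x in mu. norm ((cmod (h x * f x))\<^sup>2) \<le> norm (B\<^sup>2 * (cmod (f x))\<^sup>2)"
      using h(3) by (auto simp: norm_mult power_mult_distrib intro!: mult_right_mono power_mono)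
  qed measurable
  then show ?thesis
    using f h by (simp add: L2_def periodic_def)
qed

lemma L2_cmult: "f \<in> L2 \<Longrightarrow> (\<lambda>x. c * f x) \<in> L2"
  by (rule L2_mult_bounded[where B="cmod c"]) (auto simp: periodic_def)

lemma L2_e_mult: "f \<in> L2 \<Longrightarrow> (\<lambda>x. e k x * f x) \<in> L2"
  by (rule L2_mult_bounded[where B=1]) (auto simp: periodic_e)

lemma L2_diff: "f \<in> L2 \<Longrightarrow> g \<in> L2 \<Longrightarrow> (\<lambda>x. f x - g x) \<in> L2"
  using L2_add[OF _ L2_cmult[of g "-1"]] by simp

lemma L2_sum:
  assumes "\<And>k. k \<in> F \<Longrightarrow> f k \<in> L2"
  shows "(\<lambda>x. \<Sum>k\<in>F. f k x) \<in> L2"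
proof -
  have "(\<lambda>x. 0) \<in> L2" by (simp add: L2_def periodic_def)
  then show ?thesis
    using assms by (induction F rule: infinite_finite_induct) (auto intro: L2_add)
qed

lemma fourier_sum_in_L2: "(\<lambda>x. \<Sum>k\<in>F. c k * e k x) \<in> L2"
  by (intro L2_sum L2_cmult e_in_L2)

lemma L2_norm_nonneg: "L2_norm f \<ge> 0"
  by (simp add: L2_norm_def)

text \<open>
  With absolute values inside the integral, the case \<open>g = e 0\<close> bounds the \<open>L1\<close> norm by the \<open>L2\<close> norm.
\<close>

lemma L2_Cauchy_Schwarz:
  assumes "f \<in> L2" "g \<in> L2"
  shows "(\<integral>x. cmod (f x) * cmod (g x) \<partial>mu) \<le> L2_norm f * L2_norm g"
proof -
  note [measurable] = assms[THEN L2_measurable]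
  have "(\<integral>\<^sup>+x. ennreal (cmod (f x)) * ennreal (cmod (g x)) \<partial>mu)\<^sup>2
      \<le> (\<integral>\<^sup>+x. (ennreal (cmod (f x)))\<^sup>2 \<partial>mu) * (\<integral>\<^sup>+x. (ennreal (cmod (g x)))\<^sup>2 \<partial>mu)"
    by (rule Cauchy_Schwarz_nn_integral) measurable
  moreover have "(\<integral>\<^sup>+x. ennreal (cmod (f x)) * ennreal (cmod (g x)) \<partial>mu) = ennreal (\<integral>x. cmod (f x) * cmod (g x) \<partial>mu)"
    using nn_integral_eq_integral[OF L2_integrable_norm_mult[OF assms]] by (simp add: ennreal_mult)
  moreover have "(\<integral>\<^sup>+x. (ennreal (cmod (h x)))\<^sup>2 \<partial>mu) = ennreal ((L2_norm h)\<^sup>2)" if "h \<in> L2" for h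
    using nn_integral_eq_integral[OF L2_integrable_square[OF that]] by (simp add: ennreal_power L2_norm_square)
  ultimately have "ennreal ((\<integral>x. cmod (f x) * cmod (g x) \<partial>mu)\<^sup>2) \<le> ennreal ((L2_norm f * L2_norm g)\<^sup>2)"
    using assms by (simp add: ennreal_power integral_nonneg power_mult_distrib ennreal_mult)
  then have "(\<integral>x. cmod (f x) * cmod (g x) \<partial>mu)\<^sup>2 \<le> (L2_norm f * L2_norm g)\<^sup>2"
    by simp
  then show ?thesis
    by (rule power2_le_imp_le) (simp add: L2_norm_nonneg)
qed

lemma L2_inner_bound:
  assumes "f \<in> L2" "g \<in> L2"
  shows "cmod (\<integral>x. f x * cnj (g x) \<partial>mu) \<le> L2_norm f * L2_norm g"
proof -
  have "cmod (\<integral>x. f x * cnj (g x) \<partial>mu) \<le> (\<integral>x. cmod (f x * cnj (g x)) \<partial>mu)"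
    by (rule integral_norm_bound)
  with L2_Cauchy_Schwarz[OF assms] show ?thesis
    by (simp add: norm_mult)
qed

lemma cmod_square_eq: "complex_of_real ((cmod z)\<^sup>2) = z * cnj z"
  using complex_norm_square[of z] by simp

lemma integral_norm_square_eq_inner:
  "complex_of_real (\<integral>x. (cmod (f x))\<^sup>2 \<partial>mu) = (\<integral>x. f x * cnj (f x) \<partial>mu)"
  unfolding integral_complex_of_real[symmetric] cmod_square_eq ..

lemma fourier_coeff_eq_inner: "fourier_coeff f k = (\<integral>x. f x * cnj (e k x) \<partial>mu)"
  by (simp add: fourier_coeff_def cnj_e mult.commute)

lemma fourier_coeff_e_mult: "fourier_coeff (\<lambda>x. e m x * f x) k = fourier_coeff f (k - m)"
  by (simp add: fourier_coeff_def mult.assoc[symmetric] e_add)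

lemma fourier_coeff_diff:
  "f \<in> L2 \<Longrightarrow> g \<in> L2 \<Longrightarrow> fourier_coeff (\<lambda>x. f x - g x) k = fourier_coeff f k - fourier_coeff g k"
  unfolding fourier_coeff_eq_inner
  by (subst Bochner_Integration.integral_diff[symmetric])
     (auto intro!: L2_integrable_inner e_in_L2 simp: algebra_simps)

lemma fourier_coeff_cmult: "fourier_coeff (\<lambda>x. c * f x) k = c * fourier_coeff f k"
  by (simp add: fourier_coeff_def mult.left_commute)

lemma inner_fourier_sum:
  assumes "g \<in> L2"
  shows "(\<integral>x. (\<Sum>k\<in>F. c k * e k x) * cnj (g x) \<partial>mu) = (\<Sum>k\<in>F. c k * cnj (fourier_coeff g k))"
proof -
  have "(\<integral>x. (\<Sum>k\<in>F. c k * e k x) * cnj (g x) \<partial>mu) = (\<integral>x. (\<Sum>k\<in>F. c k * (e k x * cnj (g x))) \<partial>mu)"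
    by (simp add: sum_distrib_right mult.assoc)
  also have "\<dots> = (\<Sum>k\<in>F. \<integral>x. c k * (e k x * cnj (g x)) \<partial>mu)"
    by (intro Bochner_Integration.integral_sum integrable_mult_right L2_integrable_inner e_in_L2 assms)
  also have "\<dots> = (\<Sum>k\<in>F. c k * cnj (fourier_coeff g k))"
    by (simp add: fourier_coeff_eq_inner mult.commute flip: Bochner_Integration.integral_cnj)
  finally show ?thesis .
qed

lemma fourier_coeff_e: "fourier_coeff (e j) k = of_bool (k = j)"
  using integral_e_mu[of "j - k"] by (auto simp: fourier_coeff_def e_add)

lemma fourier_coeff_fourier_sum:
  assumes "finite F"
  shows "fourier_coeff (\<lambda>x. \<Sum>k\<in>F. c k * e k x) j = (if j \<in> F then c j else 0)"
proof -
  have "fourier_coeff (\<lambda>x. \<Sum>k\<in>F. c k * e k x) j = (\<Sum>k\<in>F. c k * of_bool (k = j))"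
    unfolding fourier_coeff_eq_inner[of "\<lambda>x. \<Sum>k\<in>F. c k * e k x"] inner_fourier_sum[OF e_in_L2]
    by (auto simp: fourier_coeff_e intro!: sum.cong)
  also have "\<dots> = (\<Sum>k\<in>F. if k = j then c k else 0)"
    by (intro sum.cong) auto
  finally show ?thesis using assms by simp
qed

lemma L2_norm_fourier_sum:
  assumes "finite F"
  shows "(L2_norm (\<lambda>x. \<Sum>k\<in>F. c k * e k x))\<^sup>2 = (\<Sum>k\<in>F. (cmod (c k))\<^sup>2)"
proof -
  have "complex_of_real ((L2_norm (\<lambda>x. \<Sum>k\<in>F. c k * e k x))\<^sup>2) = (\<Sum>k\<in>F. c k * cnj (if k \<in> F then c k else 0))"
    unfolding L2_norm_square integral_norm_square_eq_inner
    by (simp only: inner_fourier_sum[OF fourier_sum_in_L2] fourier_coeff_fourier_sum[OF assms])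
  also have "\<dots> = complex_of_real (\<Sum>k\<in>F. (cmod (c k))\<^sup>2)"
    unfolding of_real_sum cmod_square_eq by (intro sum.cong) auto
  finally show ?thesis by (simp only: of_real_eq_iff)
qed

text \<open>
  The partial sum \<open>S\<close> of the series of \<open>f\<close> satisfies \<open>\<parallel>S\<parallel>\<^sup>2 = \<langle>S, f\<rangle> \<le> \<parallel>S\<parallel> \<parallel>f\<parallel>\<close>.
\<close>

lemma Bessel_finite:
  assumes f: "f \<in> L2" and F: "finite F"
  shows "(\<Sum>k\<in>F. (cmod (fourier_coeff f k))\<^sup>2) \<le> (L2_norm f)\<^sup>2"
proof -
  define c where "c = fourier_coeff f"
  define S where "S x = (\<Sum>k\<in>F. c k * e k x)" for x
  have S: "S \<in> L2" unfolding S_def by (rule fourier_sum_in_L2)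
  have i: "complex_of_real (\<Sum>k\<in>F. (cmod (c k))\<^sup>2) = (\<integral>x. S x * cnj (f x) \<partial>mu)"
    unfolding S_def by (subst inner_fourier_sum[OF f]) (simp only: c_def cmod_square_eq of_real_sum)
  have "(\<Sum>k\<in>F. (cmod (c k))\<^sup>2) = cmod (\<integral>x. S x * cnj (f x) \<partial>mu)"
    unfolding i[symmetric] by (simp add: sum_nonneg del: of_real_sum)
  also have "\<dots> \<le> L2_norm S * L2_norm f"
    by (rule L2_inner_bound[OF S f])
  finally have "(L2_norm S)\<^sup>2 \<le> L2_norm S * L2_norm f"
    unfolding S_def L2_norm_fourier_sum[OF F] .
  then have "L2_norm S \<le> L2_norm f"
    using L2_norm_nonneg[of S] L2_norm_nonneg[of f] by (cases "L2_norm S = 0") (auto simp: power2_eq_square)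
  then have "(L2_norm S)\<^sup>2 \<le> (L2_norm f)\<^sup>2"
    by (intro power_mono L2_norm_nonneg)
  then show ?thesis
    unfolding S_def L2_norm_fourier_sum[OF F] c_def .
qed

lemma Bessel_summable: "f \<in> L2 \<Longrightarrow> (\<lambda>k. (cmod (fourier_coeff f k))\<^sup>2) summable_on UNIV"
  by (rule nonneg_bdd_above_summable_on) (auto intro!: bdd_aboveI2 Bessel_finite)

lemma Bessel_infsum: "f \<in> L2 \<Longrightarrow> (\<Sum>\<^sub>\<infinity>k. (cmod (fourier_coeff f k))\<^sup>2) \<le> (L2_norm f)\<^sup>2"
  by (rule infsum_le_finite_sums) (auto intro!: Bessel_summable Bessel_finite)

text \<open>
  Links unconditional sums over the integers with the symmetric partial sums that define
  \<open>L2_fourier_series\<close>.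
\<close>

lemma filterlim_symmetric_intervals:
  "filterlim (\<lambda>N. {- int N..int N}) (finite_subsets_at_top UNIV) sequentially"
  unfolding filterlim_finite_subsets_at_top
proof safe
  fix X :: "int set" assume X: "finite X"
  define M where "M = nat (Max (insert 0 (abs ` X)))"
  have "X \<subseteq> {- int N..int N}" if "N \<ge> M" for N
  proof
    fix k assume "k \<in> X"
    then have "\<bar>k\<bar> \<le> Max (insert 0 (abs ` X))" using X by (intro Max_ge) auto
    then show "k \<in> {- int N..int N}" using that by (auto simp: M_def)
  qed
  then show "\<forall>\<^sub>F N in sequentially. finite {- int N..int N} \<and> X \<subseteq> {- int N..int N} \<and> {- int N..int N} \<subseteq> UNIV"
    by (auto simp: eventually_sequentially)
qed

lemma has_sum_imp_symmetric_sums: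
  "(f has_sum S) UNIV \<Longrightarrow> (\<lambda>N. \<Sum>k\<in>{- int N..int N}. f k) \<longlonglongrightarrow> S"
  unfolding has_sum_def by (rule filterlim_compose[OF _ filterlim_symmetric_intervals])

section \<open>The Riesz--Fischer theorem\<close>

text \<open>
  The inner product with \<open>h\<close> is continuous, and against a partial sum it is a finite sum.
\<close>

lemma L2_fourier_series_inner:
  assumes g: "L2_fourier_series c g" and h: "h \<in> L2"
  shows "(\<lambda>N. \<Sum>k\<in>{- int N..int N}. c k * cnj (fourier_coeff h k)) \<longlonglongrightarrow> (\<integral>x. g x * cnj (h x) \<partial>mu)"
proof -
  define S where "S N x = (\<Sum>k\<in>{- int N..int N}. c k * e k x)" for N x
  have gL: "g \<in> L2" and lim: "(\<lambda>N. L2_norm (\<lambda>x. g x - S N x)) \<longlonglongrightarrow> 0"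
    using g by (auto simp: L2_fourier_series_def S_def)
  have SL: "S N \<in> L2" for N unfolding S_def by (rule fourier_sum_in_L2)
  have "(\<lambda>N. (\<integral>x. g x * cnj (h x) \<partial>mu) - (\<integral>x. S N x * cnj (h x) \<partial>mu)) \<longlonglongrightarrow> 0"
  proof (rule Lim_null_comparison)
    show "(\<lambda>N. L2_norm (\<lambda>x. g x - S N x) * L2_norm h) \<longlonglongrightarrow> 0"
      by (rule tendsto_mult_left_zero[OF lim])
    have "cmod ((\<integral>x. g x * cnj (h x) \<partial>mu) - (\<integral>x. S N x * cnj (h x) \<partial>mu)) \<le> L2_norm (\<lambda>x. g x - S N x) * L2_norm h" for N
      using L2_inner_bound[OF L2_diff[OF gL SL[of N]] h]
      by (simp add: left_diff_distrib L2_integrable_inner gL SL h)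
    then show "\<forall>\<^sub>F N in sequentially. cmod ((\<integral>x. g x * cnj (h x) \<partial>mu) - (\<integral>x. S N x * cnj (h x) \<partial>mu))
        \<le> L2_norm (\<lambda>x. g x - S N x) * L2_norm h"
      by simp
  qed
  then have "(\<lambda>N. (\<integral>x. g x * cnj (h x) \<partial>mu) - ((\<integral>x. g x * cnj (h x) \<partial>mu) - (\<integral>x. S N x * cnj (h x) \<partial>mu)))
      \<longlonglongrightarrow> (\<integral>x. g x * cnj (h x) \<partial>mu) - 0"
    by (intro tendsto_intros)
  then show ?thesis
    by (simp add: S_def inner_fourier_sum[OF h])
qed

lemma L2_fourier_series_coeff:
  assumes g: "L2_fourier_series c g"
  shows "fourier_coeff g j = c j"
proof -
  have "cnj (fourier_coeff (e j) k) = of_bool (k = j)" for k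
    by (simp add: fourier_coeff_e)
  then have "(\<lambda>N. \<Sum>k\<in>{- int N..int N}. c k * of_bool (k = j)) \<longlonglongrightarrow> fourier_coeff g j"
    using L2_fourier_series_inner[OF g e_in_L2[of j]] by (simp only: fourier_coeff_eq_inner[of g])
  moreover have "(\<lambda>N. \<Sum>k\<in>{- int N..int N}. c k * of_bool (k = j)) \<longlonglongrightarrow> c j"
  proof (rule tendsto_eventually)
    have "(\<Sum>k\<in>{- int N..int N}. c k * of_bool (k = j)) = c j" if "N \<ge> nat \<bar>j\<bar>" for N
    proof -
      have "(\<Sum>k\<in>{- int N..int N}. c k * of_bool (k = j)) = (\<Sum>k\<in>{- int N..int N}. if k = j then c k else 0)"
        by (intro sum.cong) auto
      moreover have "j \<in> {- int N..int N}" using that by auto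
      ultimately show ?thesis by simp
    qed
    then show "\<forall>\<^sub>F N in sequentially. (\<Sum>k\<in>{- int N..int N}. c k * of_bool (k = j)) = c j"
      by (auto simp: eventually_sequentially)
  qed
  ultimately show ?thesis by (rule LIMSEQ_unique)
qed

lemma abs_summable_mult_of_square_summable:
  fixes a b :: "int \<Rightarrow> complex"
  assumes "(\<lambda>k. (cmod (a k))\<^sup>2) summable_on UNIV" "(\<lambda>k. (cmod (b k))\<^sup>2) summable_on UNIV"
  shows "(\<lambda>k. cmod (a k * b k)) summable_on UNIV"
proof (rule abs_summable_product)
  show "(\<lambda>k. cmod (a k * a k)) summable_on UNIV" "(\<lambda>k. cmod (b k * b k)) summable_on UNIV"
    using assms by (simp_all add: norm_mult power2_eq_square)
qed

text \<open>
  The symmetric partial sums converge to the inner product, and the series converges absolutely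
  because both coefficient sequences are square summable; so the unconditional sum has the same value.
\<close>

lemma Parseval_inner:
  assumes g: "L2_fourier_series c g" and h: "h \<in> L2"
  shows "((\<lambda>k. c k * cnj (fourier_coeff h k)) has_sum (\<integral>x. g x * cnj (h x) \<partial>mu)) UNIV"
proof -
  have "g \<in> L2" and c: "fourier_coeff g = c"
    using g L2_fourier_series_coeff[OF g] by (auto simp: L2_fourier_series_def)
  then have "(\<lambda>k. cmod (c k * cnj (fourier_coeff h k))) summable_on UNIV"
    using Bessel_summable[of g] Bessel_summable[OF h]
    by (intro abs_summable_mult_of_square_summable) auto
  then have s: "((\<lambda>k. c k * cnj (fourier_coeff h k)) has_sum (\<Sum>\<^sub>\<infinity>k. c k * cnj (fourier_coeff h k))) UNIV"
    by (rule has_sum_infsum[OF abs_summable_summable])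
  have "(\<Sum>\<^sub>\<infinity>k. c k * cnj (fourier_coeff h k)) = (\<integral>x. g x * cnj (h x) \<partial>mu)"
    by (rule LIMSEQ_unique[OF has_sum_imp_symmetric_sums[OF s] L2_fourier_series_inner[OF g h]])
  with s show ?thesis by (simp only:)
qed

text \<open>
  Pass to a subsequence of the symmetric partial sums \<open>S\<close> whose successive differences have norm at most
  \<open>2\<^sup>-\<^sup>n\<close>. Their \<open>L1\<close> norms are summable, hence the subsequence converges almost
  everywhere; by the lemma of Fatou the pointwise limit \<open>g\<close> is at distance at most the square root of the tail
  of the coefficient series from each \<open>S N\<close>.
\<close>

theorem Riesz_Fischer:
  fixes c :: "int \<Rightarrow> complex"
  assumes c: "(\<lambda>k. (cmod (c k))\<^sup>2) summable_on UNIV"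
  shows "\<exists>g. L2_fourier_series c g"
proof -
  define S where "S N x = (\<Sum>k\<in>{- int N..int N}. c k * e k x)" for N x
  define A where "A N = (\<Sum>k\<in>{- int N..int N}. (cmod (c k))\<^sup>2)" for N
  define T where "T = (\<Sum>\<^sub>\<infinity>k. (cmod (c k))\<^sup>2)"
  have SL: "S N \<in> L2" for N unfolding S_def by (rule fourier_sum_in_L2)
  note [measurable] = SL[THEN L2_measurable]
  have A: "A \<longlonglongrightarrow> T"
    unfolding A_def T_def by (rule has_sum_imp_symmetric_sums[OF has_sum_infsum[OF c]])
  have AT: "A N \<le> T" for N
    unfolding A_def T_def by (rule finite_sum_le_infsum[OF c]) auto
  have SA: "(L2_norm (\<lambda>x. S M x - S N x))\<^sup>2 = A M - A N" if "N \<le> M" for M N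
  proof -
    have sub: "{- int N..int N} \<subseteq> {- int M..int M}" using that by auto
    have "S M x - S N x = (\<Sum>k\<in>{- int M..int M} - {- int N..int N}. c k * e k x)" for x
      unfolding S_def by (simp add: sum_diff[OF _ sub])
    moreover have "A M - A N = (\<Sum>k\<in>{- int M..int M} - {- int N..int N}. (cmod (c k))\<^sup>2)"
      unfolding A_def by (simp add: sum_diff[OF _ sub])
    ultimately show ?thesis by (simp add: L2_norm_fourier_sum)
  qed
  \<comment> \<open>The tails are squared norms, so \<open>(1/4)^n\<close> gives differences of norm at most \<open>(1/2)^n\<close>.\<close>
  have "\<exists>N. \<forall>m\<ge>N. T - A m < (1/4)^n" for n :: nat
  proof -
    have "(\<lambda>m. T - A m) \<longlonglongrightarrow> T - T" by (intro tendsto_intros A)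
    then have "\<forall>\<^sub>F m in sequentially. T - A m < (1/4)^n" by (rule order_tendstoD) simp
    then show ?thesis by (simp add: eventually_sequentially)
  qed
  then obtain r0 where r0: "\<And>n m. m \<ge> r0 n \<Longrightarrow> T - A m < (1/4)^n" by metis
  \<comment> \<open>The partial sums make \<open>r\<close> increasing, the summand \<open>n\<close> makes it unbounded.\<close>
  define r where "r n = n + (\<Sum>i\<le>n. r0 i)" for n
  have r: "T - A (r n) < (1/4)^n" and r_Suc: "r n \<le> r (Suc n)" and r_ge: "n \<le> r n" for n
    using r0[of n "r n"] by (auto simp: r_def trans_le_add2 member_le_sum)
  define D where "D n x = S (r (Suc n)) x - S (r n) x" for n x
  have DL: "D n \<in> L2" for n unfolding D_def by (intro L2_diff SL)
  note [measurable] = DL[THEN L2_measurable]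
  have D: "(\<integral>\<^sup>+x. ennreal (cmod (D n x)) \<partial>mu) \<le> ennreal ((1/2)^n)" for n
  proof -
    have "(L2_norm (D n))\<^sup>2 \<le> ((1/2)^n)\<^sup>2"
      using SA[OF r_Suc[of n]] r[of n] AT[of "r (Suc n)"]
      by (simp add: D_def[abs_def] power2_eq_square flip: power_mult_distrib)
    then have "L2_norm (D n) \<le> (1/2)^n" by (rule power2_le_imp_le) simp
    moreover have "(\<integral>x. cmod (D n x) \<partial>mu) \<le> L2_norm (D n)"
    proof -
      have "L2_norm (e 0) = 1" using mu.prob_space by (simp add: L2_norm_def)
      then show ?thesis using L2_Cauchy_Schwarz[OF DL[of n] e_in_L2[of 0]] by simp
    qed
    moreover have "(\<integral>\<^sup>+x. ennreal (cmod (D n x)) \<partial>mu) = ennreal (\<integral>x. cmod (D n x) \<partial>mu)"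
      by (intro nn_integral_eq_integral integrable_norm L2_integrable DL) simp
    ultimately show ?thesis by (simp add: ennreal_leI)
  qed
  have "(\<integral>\<^sup>+x. (\<Sum>n. ennreal (cmod (D n x))) \<partial>mu) = (\<Sum>n. \<integral>\<^sup>+x. ennreal (cmod (D n x)) \<partial>mu)"
    by (rule nn_integral_suminf) measurable
  also have "\<dots> \<le> (\<Sum>n. ennreal ((1/2)^n))"
    by (intro suminf_le D summableI)
  also have "\<dots> = ennreal (\<Sum>n. (1/2)^n)"
    by (intro suminf_ennreal2) (auto intro!: summable_geometric)
  finally have "(\<integral>\<^sup>+x. (\<Sum>n. ennreal (cmod (D n x))) \<partial>mu) \<noteq> \<infinity>"
    by (auto simp: top_unique)
  moreover have "(\<lambda>x. \<Sum>n. ennreal (cmod (D n x))) \<in> borel_measurable mu"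
    by measurable
  ultimately have "AE x in mu. (\<Sum>n. ennreal (cmod (D n x))) \<noteq> \<infinity>"
    by (intro nn_integral_noteq_infinite)
  then have conv: "AE x in mu. convergent (\<lambda>n. S (r n) x)"
  proof eventually_elim
    case (elim x)
    then have "summable (\<lambda>n. cmod (D n x))"
      by (intro summable_suminf_not_top) auto
    then have "summable (\<lambda>n. D n x)" by (rule summable_norm_cancel)
    then have "convergent (\<lambda>n. \<Sum>i<n. D i x)" by (simp add: summable_iff_convergent)
    moreover have "(\<Sum>i<n. D i x) = S (r n) x - S (r 0) x" for n
      unfolding D_def by (rule sum_lessThan_telescope)
    ultimately have "convergent (\<lambda>n. S (r n) x - S (r 0) x)" by simp
    then show ?case by (simp add: convergent_diff_const_right_iff)
  qed
  define g where "g x = lim (\<lambda>n. S (r n) x)" for x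
  have g_lim: "AE x in mu. (\<lambda>n. S (r n) x) \<longlonglongrightarrow> g x"
    using conv by eventually_elim (simp add: g_def convergent_LIMSEQ_iff)
  have [measurable]: "g \<in> borel_measurable borel"
    unfolding g_def by measurable
  have per: "periodic g"
    using SL[THEN L2_periodic] by (simp add: periodic_def g_def)
  have dist: "(\<integral>\<^sup>+x. ennreal ((cmod (g x - S N x))\<^sup>2) \<partial>mu) \<le> ennreal (T - A N)" for N
  proof -
    have "(\<integral>\<^sup>+x. ennreal ((cmod (g x - S N x))\<^sup>2) \<partial>mu) = (\<integral>\<^sup>+x. liminf (\<lambda>n. ennreal ((cmod (S (r n) x - S N x))\<^sup>2)) \<partial>mu)"
    proof (rule nn_integral_cong_AE)
      show "AE x in mu. ennreal ((cmod (g x - S N x))\<^sup>2) = liminf (\<lambda>n. ennreal ((cmod (S (r n) x - S N x))\<^sup>2))"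
        using g_lim
      proof eventually_elim
        case (elim x)
        then have "(\<lambda>n. ennreal ((cmod (S (r n) x - S N x))\<^sup>2)) \<longlonglongrightarrow> ennreal ((cmod (g x - S N x))\<^sup>2)"
          by (intro tendsto_intros)
        from lim_imp_Liminf[OF _ this] show ?case by simp
      qed
    qed
    also have "\<dots> \<le> liminf (\<lambda>n. \<integral>\<^sup>+x. ennreal ((cmod (S (r n) x - S N x))\<^sup>2) \<partial>mu)"
      by (rule nn_integral_liminf) measurable
    also have "\<dots> \<le> ennreal (T - A N)"
    proof (rule Liminf_le)
      have "(\<integral>\<^sup>+x. ennreal ((cmod (S (r n) x - S N x))\<^sup>2) \<partial>mu) \<le> ennreal (T - A N)" if "n \<ge> N" for n
      proof -
        have "(\<integral>\<^sup>+x. ennreal ((cmod (S (r n) x - S N x))\<^sup>2) \<partial>mu) = ennreal ((L2_norm (\<lambda>x. S (r n) x - S N x))\<^sup>2)"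
          unfolding L2_norm_square
          by (intro nn_integral_eq_integral L2_integrable_square L2_diff SL) simp
        also have "\<dots> \<le> ennreal (T - A N)"
          using SA[of N "r n"] r_ge[of n] that AT[of "r n"] by (intro ennreal_leI) simp
        finally show ?thesis .
      qed
      then show "\<forall>\<^sub>F n in sequentially. (\<integral>\<^sup>+x. ennreal ((cmod (S (r n) x - S N x))\<^sup>2) \<partial>mu) \<le> ennreal (T - A N)"
        by (auto simp: eventually_sequentially)
    qed simp
    finally show ?thesis .
  qed
  have dL: "(\<lambda>x. g x - S N x) \<in> L2" for N
  proof -
    have "integrable mu (\<lambda>x. (cmod (g x - S N x))\<^sup>2)"
      using le_less_trans[OF dist[of N]] by (intro integrableI_nonneg) auto
    then show ?thesis
      using per L2_periodic[OF SL[of N]] by (simp add: L2_def periodic_def)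
  qed
  have gL: "g \<in> L2"
    using L2_add[OF dL[of 0] SL[of 0]] by simp
  have le: "(L2_norm (\<lambda>x. g x - S N x))\<^sup>2 \<le> T - A N" for N
  proof -
    have "ennreal ((L2_norm (\<lambda>x. g x - S N x))\<^sup>2) = (\<integral>\<^sup>+x. ennreal ((cmod (g x - S N x))\<^sup>2) \<partial>mu)"
      unfolding L2_norm_square by (intro nn_integral_eq_integral[symmetric] L2_integrable_square dL) simp
    then have "ennreal ((L2_norm (\<lambda>x. g x - S N x))\<^sup>2) \<le> ennreal (T - A N)"
      using dist[of N] by (simp only:)
    then show ?thesis using AT[of N] by (subst (asm) ennreal_le_iff) auto
  qed
  have "(\<lambda>N. sqrt (T - A N)) \<longlonglongrightarrow> sqrt (T - T)"
    by (intro tendsto_intros A)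
  then have "(\<lambda>N. sqrt (T - A N)) \<longlonglongrightarrow> 0" by simp
  moreover have "\<forall>\<^sub>F N in sequentially. norm (L2_norm (\<lambda>x. g x - S N x)) \<le> sqrt (T - A N)"
    using le by (simp add: L2_norm_nonneg real_le_rsqrt)
  ultimately have "(\<lambda>N. L2_norm (\<lambda>x. g x - S N x)) \<longlonglongrightarrow> 0"
    by (rule Lim_null_comparison[rotated])
  with gL show ?thesis
    unfolding L2_fourier_series_def S_def by blast
qed

section \<open>Completeness of the characters\<close>

lemma trig_poly_circle_cont: "p \<in> trig_poly \<Longrightarrow> p \<in> circle_cont"
proof (induction rule: trig_poly.induct)
  case (monomial c k)
  show ?case
    by (auto simp: circle_cont_def periodic_def e_periodic intro!: continuous_intros)
next
  case (add p q)
  then show ?case by (auto simp: circle_cont_def periodic_def intro!: continuous_intros)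
qed

lemma circle_cont_bounded:
  assumes "\<phi> \<in> circle_cont"
  obtains B where "B \<ge> 0" "\<And>x. cmod (\<phi> x) \<le> B"
proof -
  obtain p where p: "p \<in> trig_poly" "\<And>x. cmod (\<phi> x - p x) < 1"
    using trig_poly_dense[OF assms, of 1] by auto
  have "\<exists>B. \<forall>x. cmod (p x) \<le> B"
    using p(1)
  proof (induction rule: trig_poly.induct)
    case (monomial c k)
    show ?case by (intro exI[of _ "cmod c"]) (simp add: norm_mult)
  next
    case (add p q)
    then obtain B C where "\<And>x. cmod (p x) \<le> B" "\<And>x. cmod (q x) \<le> C" by blast
    then show ?case by (intro exI[of _ "B + C"] allI norm_triangle_mono)
  qed
  then obtain B where B: "\<And>x. cmod (p x) \<le> B" by blast
  have bound: "cmod (\<phi> x) \<le> 1 + B" for x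
    using norm_triangle_mono[OF less_imp_le[OF p(2)[of x]] B[of x]] by simp
  moreover have "0 \<le> 1 + B" using bound[of 0] norm_ge_zero[of "\<phi> 0"] by linarith
  ultimately show ?thesis using that by blast
qed

lemma circle_cont_measurable: "\<phi> \<in> circle_cont \<Longrightarrow> \<phi> \<in> borel_measurable borel"
  by (auto simp: circle_cont_def intro: borel_measurable_continuous_onI)

lemma circle_cont_diff: "\<phi> \<in> circle_cont \<Longrightarrow> \<psi> \<in> circle_cont \<Longrightarrow> (\<lambda>x. \<phi> x - \<psi> x) \<in> circle_cont"
  by (auto simp: circle_cont_def periodic_def intro!: continuous_intros)

lemma integrable_circle_cont:
  assumes "\<phi> \<in> circle_cont" "finite_measure M" "sets M = sets borel"
  shows "integrable M \<phi>"
proof -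
  interpret finite_measure M by fact
  obtain B where "\<And>x. cmod (\<phi> x) \<le> B" using circle_cont_bounded[OF assms(1)] by blast
  then show ?thesis
    using circle_cont_measurable[OF assms(1)] assms(3)
    by (intro integrable_const_bound[where B=B]) (auto cong: measurable_cong_sets)
qed

lemma integrable_circle_cont_mult:
  fixes h :: "real \<Rightarrow> complex"
  assumes h: "integrable mu h" and \<phi>: "\<phi> \<in> circle_cont"
  shows "integrable mu (\<lambda>x. \<phi> x * h x)"
proof -
  obtain B where B: "B \<ge> 0" "\<And>x. cmod (\<phi> x) \<le> B" using circle_cont_bounded[OF \<phi>] by blast
  have [measurable]: "\<phi> \<in> borel_measurable borel" "h \<in> borel_measurable mu"
    using circle_cont_measurable[OF \<phi>] h by auto
  show ?thesis
  proof (rule Bochner_Integration.integrable_bound)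
    show "integrable mu (\<lambda>x. B * cmod (h x))"
      using h by (intro integrable_mult_right integrable_norm)
    show "AE x in mu. norm (\<phi> x * h x) \<le> norm (B * cmod (h x))"
      using B by (auto simp: norm_mult intro!: mult_right_mono)
  qed measurable
qed

lemma integral_circle_cont_mult_le:
  fixes h :: "real \<Rightarrow> complex"
  assumes h: "integrable mu h" and \<phi>: "\<phi> \<in> circle_cont" and B: "\<And>x. cmod (\<phi> x) \<le> B"
  shows "cmod (\<integral>x. \<phi> x * h x \<partial>mu) \<le> B * (\<integral>x. cmod (h x) \<partial>mu)"
proof -
  have "cmod (\<integral>x. \<phi> x * h x \<partial>mu) \<le> (\<integral>x. cmod (\<phi> x * h x) \<partial>mu)"
    by (rule integral_norm_bound)
  also have "\<dots> \<le> (\<integral>x. B * cmod (h x) \<partial>mu)"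
    using h B by (intro integral_mono integrable_norm integrable_circle_cont_mult \<phi> integrable_mult_right)
      (auto simp: norm_mult intro!: mult_right_mono)
  finally show ?thesis by simp
qed

text \<open>
  Vanishing Fourier coefficients annihilate trigonometric polynomials, and these are dense.
\<close>

lemma integral_circle_cont_eq_zero:
  assumes h: "integrable mu h" and zero: "\<And>k. fourier_coeff h k = 0" and \<phi>: "\<phi> \<in> circle_cont"
  shows "(\<integral>x. \<phi> x * h x \<partial>mu) = 0"
proof -
  have trig: "(\<integral>x. p x * h x \<partial>mu) = 0" if "p \<in> trig_poly" for p
    using that
  proof (induction rule: trig_poly.induct)
    case (monomial c k)
    show ?case using zero[of "- k"] by (simp add: fourier_coeff_def mult.assoc)
  next
    case (add p q)
    then show ?case
      using integrable_circle_cont_mult[OF h] by (simp add: distrib_right trig_poly_circle_cont)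
  qed
  have "cmod (\<integral>x. \<phi> x * h x \<partial>mu) \<le> \<delta> * (\<integral>x. cmod (h x) \<partial>mu)" if \<delta>: "\<delta> > 0" for \<delta>
  proof -
    obtain p where p: "p \<in> trig_poly" "\<And>x. cmod (\<phi> x - p x) < \<delta>"
      using trig_poly_dense[OF \<phi> \<delta>] by blast
    have "(\<integral>x. \<phi> x * h x \<partial>mu) = (\<integral>x. (\<phi> x - p x) * h x \<partial>mu)"
      using trig[OF p(1)] integrable_circle_cont_mult[OF h] \<phi> trig_poly_circle_cont[OF p(1)]
      by (simp add: left_diff_distrib)
    also have "cmod \<dots> \<le> \<delta> * (\<integral>x. cmod (h x) \<partial>mu)"
      using p by (intro integral_circle_cont_mult_le h circle_cont_diff \<phi> trig_poly_circle_cont less_imp_le)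
    finally show ?thesis .
  qed
  note le = this
  have "((\<lambda>\<delta>. \<delta> * (\<integral>x. cmod (h x) \<partial>mu)) \<longlongrightarrow> 0 * (\<integral>x. cmod (h x) \<partial>mu)) (at_right 0)"
    by (intro tendsto_intros)
  moreover have "\<forall>\<^sub>F \<delta> in at_right 0. cmod (\<integral>x. \<phi> x * h x \<partial>mu) \<le> \<delta> * (\<integral>x. cmod (h x) \<partial>mu)"
    by (rule eventually_mono[OF eventually_at_right_less[of "0::real"]]) (rule le)
  ultimately have "cmod (\<integral>x. \<phi> x * h x \<partial>mu) \<le> 0 * (\<integral>x. cmod (h x) \<partial>mu)"
    by (rule tendsto_lowerbound) simp
  then show ?thesis by simp
qed

lemma cis_inj_on_fundamental:
  assumes "cis x = cis y" "x \<in> {0..<2*pi}" "y \<in> {0..<2*pi}"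
  shows "x = y"
proof -
  have "Arg2pi (cis t) = t" if "t \<in> {0..<2*pi}" for t
  proof (rule Arg2pi_unique)
    show "complex_of_real 1 * exp (\<i> * complex_of_real t) = cis t"
      by (simp add: cis_conv_exp)
  qed (use that in auto)
  from this[OF assms(2)] this[OF assms(3)] show ?thesis unfolding assms(1) by (rule trans[OF sym])
qed

text \<open>
  For \<open>t \<ge> 0\<close>, the indicator of \<open>{..t}\<close> is on the circle the indicator of the compact arc \<open>cis ` {0..t}\<close>, a
  pointwise limit of the continuous functions \<open>max 0 (1 - n d)\<close> of the distance \<open>d\<close> to that arc.
\<close>

lemma integral_atMost_eq_zero:
  assumes h: "integrable mu h" and zero: "\<And>k. fourier_coeff h k = 0"
  shows "(LINT x:{..t}|mu. h x) = 0"
proof (cases "t < 0")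
  case True
  have "(LINT x:{..t}|mu. h x) = (\<integral>x. 0 \<partial>mu)"
    unfolding set_lebesgue_integral_def
    using AE_mu_fundamental by (intro integral_cong_AE) (use h True in \<open>auto elim!: eventually_mono\<close>)
  then show ?thesis by simp
next
  case False
  define C where "C = cis ` {0..min t (2*pi)}"
  have C: "closed C" "C \<noteq> {}"
    using False by (auto simp: C_def intro!: compact_imp_closed compact_continuous_image continuous_intros)
  define \<phi> where "\<phi> n x = complex_of_real (max 0 (1 - real n * infdist (cis x) C))" for n x
  have \<phi>_cont: "\<phi> n \<in> circle_cont" for n
  proof -
    have "cis (x + 2*pi) = cis x" for x by (simp add: complex_eq_iff)
    then show ?thesis
      by (auto simp: \<phi>_def circle_cont_def periodic_def intro!: continuous_intros)
  qed
  note [measurable] = circle_cont_measurable[OF \<phi>_cont]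
  have h_meas [measurable]: "h \<in> borel_measurable mu" using h by simp
  have lim: "(\<lambda>n. \<phi> n x) \<longlonglongrightarrow> indicator {..t} x" if x: "x \<in> {0..<2*pi}" for x
  proof (cases "x \<le> t")
    case True
    then have "cis x \<in> C" using x by (auto simp: C_def)
    then show ?thesis using True by (simp add: \<phi>_def)
  next
    case False
    have "cis x \<notin> C"
    proof
      assume "cis x \<in> C"
      then obtain y where "cis x = cis y" "0 \<le> y" "y \<le> t" "y \<le> 2*pi" by (auto simp: C_def)
      then show False
        using cis_inj_on_fundamental[of x y] x False by auto
    qed
    then have pos: "infdist (cis x) C > 0"
      using C infdist_pos_not_in_closed by blast
    obtain N where N: "1 < real N * infdist (cis x) C"
      using reals_Archimedean3[OF pos] by blast
    have "\<phi> n x = 0" if "n \<ge> N" for n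
    proof -
      have "real N * infdist (cis x) C \<le> real n * infdist (cis x) C"
        using that pos by (intro mult_right_mono) auto
      then show ?thesis using N by (simp add: \<phi>_def)
    qed
    then have "(\<lambda>n. \<phi> n x) \<longlonglongrightarrow> 0"
      by (intro tendsto_eventually) (auto simp: eventually_sequentially)
    then show ?thesis using False by simp
  qed
  have "(\<lambda>n. \<integral>x. \<phi> n x * h x \<partial>mu) \<longlonglongrightarrow> (\<integral>x. indicator {..t} x * h x \<partial>mu)"
  proof (rule integral_dominated_convergence[where w="\<lambda>x. cmod (h x)"])
    show "AE x in mu. (\<lambda>n. \<phi> n x * h x) \<longlonglongrightarrow> indicator {..t} x * h x"
      using AE_mu_fundamental by eventually_elim (intro tendsto_intros lim)
    have "cmod (\<phi> n x) \<le> 1" for n x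
      by (simp add: \<phi>_def infdist_nonneg)
    then show "AE x in mu. norm (\<phi> n x * h x) \<le> cmod (h x)" for n
      by (auto simp: norm_mult intro!: mult_left_le_one_le)
  qed (use h in auto)
  then have "(\<integral>x. indicator {..t} x * h x \<partial>mu) = 0"
    using integral_circle_cont_eq_zero[OF h zero \<phi>_cont] by (simp add: LIMSEQ_const_iff)
  then show ?thesis
    by (simp add: set_lebesgue_integral_def scaleR_conv_of_real of_real_indicator)
qed

text \<open>
  The half-lines generate the Borel sets, so by the previous lemma every set integral of \<open>h\<close> vanishes.
\<close>

lemma fourier_coeff_unique:
  assumes h: "integrable mu h" and zero: "\<And>k. fourier_coeff h k = 0"
  shows "AE x in mu. h x = 0"
proof (rule mu.density_zero[OF h])
  fix A assume "A \<in> sets mu"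
  then have A: "A \<in> sigma_sets UNIV (range (\<lambda>t::real. {..t}))"
    by (simp add: borel_eq_atMost)
  have "Int_stable (range (\<lambda>t::real. {..t}))"
    by (auto simp: Int_stable_def)
  from this subset_UNIV[of "range (\<lambda>t::real. {..t})", folded Pow_UNIV] A
  show "set_lebesgue_integral mu A h = 0"
  proof (induction A rule: sigma_sets_induct_disjoint)
    case (basic A)
    then show ?case using integral_atMost_eq_zero[OF h zero] by auto
  next
    case empty
    show ?case by (simp add: set_lebesgue_integral_def)
  next
    case (compl A)
    have A [measurable]: "A \<in> sets borel" using compl by (simp add: borel_eq_atMost)
    have "(\<integral>x. h x \<partial>mu) = 0" using zero[of 0] by (simp add: fourier_coeff_def)
    moreover have "(\<integral>x. h x \<partial>mu) = set_lebesgue_integral mu A h + set_lebesgue_integral mu (UNIV - A) h"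
    proof -
      have i: "set_integrable mu B h" if "B \<in> sets borel" for B
        unfolding set_integrable_def using that h by (intro integrable_mult_indicator) auto
      have "set_lebesgue_integral mu (A \<union> (UNIV - A)) h = set_lebesgue_integral mu A h + set_lebesgue_integral mu (UNIV - A) h"
        by (rule set_integral_Un) (use A in \<open>auto intro!: i\<close>)
      then show ?thesis by (simp add: set_lebesgue_integral_def)
    qed
    ultimately show ?case using compl by simp
  next
    case (union A)
    have A: "A i \<in> sets borel" for i using union(2) by (auto simp: borel_eq_atMost)
    have "set_integrable mu (\<Union>i. A i) h"
      unfolding set_integrable_def using A h by (intro integrable_mult_indicator) auto
    then have "set_lebesgue_integral mu (\<Union>i. A i) h = (\<Sum>i. set_lebesgue_integral mu (A i) h)"
      using A union(1) by (intro lebesgue_integral_countable_add) (auto simp: disjoint_family_on_def)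
    then show ?case using union(3) by simp
  qed
qed

text \<open>
  The function that the Riesz--Fischer theorem attaches to the coefficients of \<open>f\<close> differs from \<open>f\<close> by
  a function with vanishing coefficients.
\<close>

lemma L2_fourier_series_self:
  assumes f: "f \<in> L2"
  shows "L2_fourier_series (fourier_coeff f) f"
proof -
  obtain g where g: "L2_fourier_series (fourier_coeff f) g"
    using Riesz_Fischer[OF Bessel_summable[OF f]] by blast
  have gL: "g \<in> L2" using g by (simp add: L2_fourier_series_def)
  have "AE x in mu. g x - f x = 0"
    using L2_fourier_series_coeff[OF g] f gL
    by (intro fourier_coeff_unique L2_integrable L2_diff) (simp_all add: fourier_coeff_diff)
  then have eq: "AE x in mu. g x = f x" by simp
  note [measurable] = L2_measurable[OF f] L2_measurable[OF gL]
  have "L2_norm (\<lambda>x. g x - S x) = L2_norm (\<lambda>x. f x - S x)" if [measurable]: "S \<in> borel_measurable borel" for S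
    unfolding L2_norm_def using eq
    by (intro arg_cong[where f=sqrt] integral_cong_AE) (auto elim!: eventually_mono)
  from this[OF L2_measurable[OF fourier_sum_in_L2]]
  have "L2_norm (\<lambda>x. f x - (\<Sum>k\<in>{- int N..int N}. fourier_coeff f k * e k x))
      = L2_norm (\<lambda>x. g x - (\<Sum>k\<in>{- int N..int N}. fourier_coeff f k * e k x))" for N
    by (rule sym)
  with g f show ?thesis by (simp add: L2_fourier_series_def)
qed

lemma Parseval:
  assumes f: "f \<in> L2"
  shows "((\<lambda>k. (cmod (fourier_coeff f k))\<^sup>2) has_sum (L2_norm f)\<^sup>2) UNIV"
proof -
  have "((\<lambda>k. complex_of_real ((cmod (fourier_coeff f k))\<^sup>2)) has_sum complex_of_real ((L2_norm f)\<^sup>2)) UNIV"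
    unfolding L2_norm_square integral_norm_square_eq_inner unfolding cmod_square_eq
    by (rule Parseval_inner[OF L2_fourier_series_self[OF f] f])
  then show ?thesis by (simp only: has_sum_of_real_iff)
qed

section \<open>Convergence of densities from convergence of their Fourier coefficients\<close>

lemma integrable_circle_cont_mult_real:
  assumes "\<phi> \<in> circle_cont" "integrable mu h"
  shows "integrable mu (\<lambda>x. \<phi> x * complex_of_real (h x))"
  using assms by (intro integrable_circle_cont_mult) auto

text \<open>
  Approximate \<open>\<phi>\<close> uniformly by a trigonometric polynomial. The error is controlled by the masses
  of the densities, which are eventually bounded since the zeroth coefficient converges.
\<close>

lemma weak_convergence_of_coefficients:
  fixes h :: "'i \<Rightarrow> real \<Rightarrow> real"
  assumes M: "finite_measure M" "sets M = sets borel"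
  assumes h: "\<forall>\<^sub>F i in F. integrable mu (h i) \<and> (\<forall>x. h i x \<ge> 0)"
  assumes coeff: "\<And>m. ((\<lambda>i. \<integral>x. e (- m) x * complex_of_real (h i x) \<partial>mu) \<longlongrightarrow> (\<integral>x. e (- m) x \<partial>M)) F"
  assumes \<phi>: "\<phi> \<in> circle_cont"
  shows "((\<lambda>i. \<integral>x. \<phi> x * complex_of_real (h i x) \<partial>mu) \<longlongrightarrow> (\<integral>x. \<phi> x \<partial>M)) F"
proof -
  interpret M: finite_measure M by fact
  have M_int: "integrable M \<psi>" if "\<psi> \<in> circle_cont" for \<psi>
    using that M by (rule integrable_circle_cont)
  have spM: "space M = UNIV" using sets_eq_imp_space_eq[OF M(2)] by simp
  have trig: "((\<lambda>i. \<integral>x. p x * complex_of_real (h i x) \<partial>mu) \<longlongrightarrow> (\<integral>x. p x \<partial>M)) F" if "p \<in> trig_poly" for p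
    using that
  proof (induction rule: trig_poly.induct)
    case (monomial c k)
    show ?case
      using tendsto_mult_left[OF coeff[of "- k"], of c] by (simp add: mult.assoc)
  next
    case (add p q)
    have "((\<lambda>i. (\<integral>x. p x * complex_of_real (h i x) \<partial>mu) + (\<integral>x. q x * complex_of_real (h i x) \<partial>mu))
        \<longlongrightarrow> (\<integral>x. p x \<partial>M) + (\<integral>x. q x \<partial>M)) F"
      by (intro tendsto_add add.IH)
    moreover have "\<forall>\<^sub>F i in F. (\<integral>x. p x * complex_of_real (h i x) \<partial>mu) + (\<integral>x. q x * complex_of_real (h i x) \<partial>mu)
        = (\<integral>x. (p x + q x) * complex_of_real (h i x) \<partial>mu)"
      using h by eventually_elim
        (simp add: distrib_right integrable_circle_cont_mult_real trig_poly_circle_cont add.hyps)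
    ultimately have "((\<lambda>i. \<integral>x. (p x + q x) * complex_of_real (h i x) \<partial>mu) \<longlongrightarrow> (\<integral>x. p x \<partial>M) + (\<integral>x. q x \<partial>M)) F"
      by (rule Lim_transform_eventually)
    then show ?case
      by (simp add: M_int trig_poly_circle_cont add.hyps)
  qed
  define K where "K = measure M (space M) + 1"
  have K: "K > 0" by (simp add: K_def add_nonneg_pos)
  have mass: "\<forall>\<^sub>F i in F. (\<integral>x. h i x \<partial>mu) < K"
  proof -
    have "((\<lambda>i. \<integral>x. h i x \<partial>mu) \<longlongrightarrow> measure M (space M)) F"
      using tendsto_Re[OF coeff[of 0]] by (simp add: spM)
    then show ?thesis by (rule order_tendstoD) (simp add: K_def)
  qed
  show ?thesis
  proof (rule tendstoI)
    fix \<eta> :: real assume \<eta>: "\<eta> > 0"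
    define \<delta> where "\<delta> = \<eta> / (3 * K)"
    have \<delta>: "\<delta> > 0" using \<eta> K by (simp add: \<delta>_def)
    obtain p where p: "p \<in> trig_poly" "\<And>x. cmod (\<phi> x - p x) < \<delta>"
      using trig_poly_dense[OF \<phi> \<delta>] by blast
    have pc: "p \<in> circle_cont" by (rule trig_poly_circle_cont[OF p(1)])
    have "\<forall>\<^sub>F i in F. dist (\<integral>x. p x * complex_of_real (h i x) \<partial>mu) (\<integral>x. p x \<partial>M) < \<eta> / 3"
      using \<eta> by (intro tendstoD[OF trig[OF p(1)]]) simp
    then show "\<forall>\<^sub>F i in F. dist (\<integral>x. \<phi> x * complex_of_real (h i x) \<partial>mu) (\<integral>x. \<phi> x \<partial>M) < \<eta>"
      using h mass
    proof eventually_elim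
      case (elim i)
      have "(\<integral>x. \<phi> x * complex_of_real (h i x) \<partial>mu) - (\<integral>x. p x * complex_of_real (h i x) \<partial>mu)
          = (\<integral>x. (\<phi> x - p x) * complex_of_real (h i x) \<partial>mu)"
        using elim \<phi> pc by (simp add: left_diff_distrib integrable_circle_cont_mult_real)
      also have "cmod \<dots> \<le> \<delta> * (\<integral>x. cmod (complex_of_real (h i x)) \<partial>mu)"
        using elim p(2) by (intro integral_circle_cont_mult_le circle_cont_diff \<phi> pc less_imp_le) auto
      also have "\<dots> = \<delta> * (\<integral>x. h i x \<partial>mu)"
        using elim by simp
      also have "\<dots> \<le> \<delta> * K"
        using elim \<delta> by (intro mult_left_mono) auto
      finally have 1: "cmod ((\<integral>x. \<phi> x * complex_of_real (h i x) \<partial>mu) - (\<integral>x. p x * complex_of_real (h i x) \<partial>mu)) \<le> \<eta> / 3"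
        using K by (simp add: \<delta>_def)
      have "(\<integral>x. \<phi> x \<partial>M) - (\<integral>x. p x \<partial>M) = (\<integral>x. \<phi> x - p x \<partial>M)"
        using \<phi> pc by (simp add: M_int)
      also have "cmod \<dots> \<le> (\<integral>x. cmod (\<phi> x - p x) \<partial>M)"
        by (rule integral_norm_bound)
      also have "\<dots> \<le> (\<integral>x. \<delta> \<partial>M)"
        using p(2) by (intro integral_mono integrable_norm M_int circle_cont_diff \<phi> pc less_imp_le) auto
      also have "\<dots> \<le> \<delta> * K"
        using \<delta> by (simp add: K_def algebra_simps)
      finally have 2: "cmod ((\<integral>x. \<phi> x \<partial>M) - (\<integral>x. p x \<partial>M)) \<le> \<eta> / 3"
        using K by (simp add: \<delta>_def)
      have 3: "cmod ((\<integral>x. p x * complex_of_real (h i x) \<partial>mu) - (\<integral>x. p x \<partial>M)) < \<eta> / 3"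
        using elim by (simp add: dist_norm)
      define A B C D where "A = (\<integral>x. \<phi> x * complex_of_real (h i x) \<partial>mu)"
        and "B = (\<integral>x. p x * complex_of_real (h i x) \<partial>mu)"
        and "C = (\<integral>x. p x \<partial>M)" and "D = (\<integral>x. \<phi> x \<partial>M)"
      have "cmod (A - D) \<le> cmod (A - B) + cmod (B - C) + cmod (D - C)"
        using norm_triangle_ineq[of "A - B" "B - C"] norm_triangle_ineq[of "A - C" "C - D"]
        by (simp add: norm_minus_commute)
      then show ?case
        using 1 2 3 by (simp add: dist_norm A_def B_def C_def D_def)
    qed
  qed
qed

section \<open>A trigonometric moment problem\<close>

text \<open>
  The representative in \<open>[0, 2 pi)\<close>. A weak limit of measures on \<open>[0, 2 pi)\<close> may charge the end point
  \<open>2 pi\<close>; its image under \<open>wrap\<close> lives on \<open>[0, 2 pi)\<close> and has the same Fourier coefficients.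
\<close>

definition wrap :: "real \<Rightarrow> real" where
  "wrap x = x - 2 * pi * of_int \<lfloor>x / (2 * pi)\<rfloor>"

lemma wrap_in: "wrap x \<in> {0..<2*pi}"
proof -
  have "wrap x = 2 * pi * frac (x / (2*pi))"
    by (simp add: wrap_def frac_def right_diff_distrib)
  then show ?thesis using frac_ge_0[of "x / (2*pi)"] frac_lt_1[of "x / (2*pi)"] by simp
qed

lemma measurable_wrap [measurable]: "wrap \<in> borel_measurable borel"
  unfolding wrap_def[abs_def] by measurable

lemma periodic_wrap: "periodic f \<Longrightarrow> f (wrap x) = f x"
  using periodic_shift_int[of f "wrap x" "\<lfloor>x / (2 * pi)\<rfloor>"] by (simp add: wrap_def)

text \<open>
  The densities become probability measures after division by their masses. These all live on a
  bounded interval and are therefore tight, so that a subsequence converges weakly by the selection theorem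
  of Helly. If the masses tend to \<open>0\<close>, then all coefficients do, and the null measure is the answer.
\<close>

theorem measure_of_limit_coefficients:
  fixes h :: "nat \<Rightarrow> real \<Rightarrow> real" and u :: "int \<Rightarrow> complex"
  assumes h: "\<And>n. integrable mu (h n)" "\<And>n x. h n x \<ge> 0"
  assumes coeff: "\<And>m. (\<lambda>n. \<integral>x. e (- m) x * complex_of_real (h n x) \<partial>mu) \<longlonglongrightarrow> u m"
  shows "\<exists>M. circle_measure M \<and> (\<forall>m. (\<integral>x. e (- m) x \<partial>M) = u m)"
proof -
  define mass where "mass n = (\<integral>x. h n x \<partial>mu)" for n
  define s where "s = Re (u 0)"
  have mass_nonneg: "mass n \<ge> 0" for n
    unfolding mass_def by (rule integral_nonneg_AE) (simp add: h)
  have mass_lim: "mass \<longlonglongrightarrow> s"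
    using tendsto_Re[OF coeff[of 0]] by (simp add: mass_def[abs_def] s_def)
  have s: "s \<ge> 0"
    by (rule LIMSEQ_le_const[OF mass_lim]) (use mass_nonneg in auto)
  have h_meas [measurable]: "h n \<in> borel_measurable mu" for n using h(1)[of n] by auto
  show ?thesis
  proof (cases "s = 0")
    case True
    have "u m = 0" for m
    proof -
      have "cmod (\<integral>x. e (- m) x * complex_of_real (h n x) \<partial>mu) \<le> mass n" for n
      proof -
        have "cmod (\<integral>x. e (- m) x * complex_of_real (h n x) \<partial>mu) \<le> (\<integral>x. cmod (e (- m) x * complex_of_real (h n x)) \<partial>mu)"
          by (rule integral_norm_bound)
        then show ?thesis using h(2) by (simp add: norm_mult mass_def)
      qed
      then have "\<forall>\<^sub>F n in sequentially. cmod (\<integral>x. e (- m) x * complex_of_real (h n x) \<partial>mu) \<le> mass n"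
        by (intro always_eventually allI)
      then have "(\<lambda>n. \<integral>x. e (- m) x * complex_of_real (h n x) \<partial>mu) \<longlonglongrightarrow> 0"
        by (rule Lim_null_comparison) (use mass_lim True in simp)
      with coeff[of m] show ?thesis by (rule LIMSEQ_unique)
    qed
    moreover have "circle_measure (null_measure borel)"
      unfolding circle_measure_def by (intro conjI finite_measureI) simp_all
    ultimately show ?thesis by (intro exI[of _ "null_measure borel"]) auto
  next
    case False
    with s have s_pos: "s > 0" by simp
    then obtain N where N: "\<And>n. n \<ge> N \<Longrightarrow> mass n > 0"
      using order_tendstoD(1)[OF mass_lim s_pos] by (auto simp: eventually_sequentially)
    \<comment> \<open>Only the densities from index \<open>N\<close> on are known to have positive mass.\<close>
    define P where "P n = density mu (\<lambda>x. ennreal (h (n + N) x / mass (n + N)))" for n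
    have pos: "mass (n + N) > 0" for n by (rule N) simp
    have P_prob: "real_distribution (P n)" for n
    proof -
      have "emeasure (P n) (space (P n)) = (\<integral>\<^sup>+x. ennreal (h (n + N) x / mass (n + N)) \<partial>mu)"
        by (simp add: P_def emeasure_density)
      also have "\<dots> = ennreal (\<integral>x. h (n + N) x / mass (n + N) \<partial>mu)"
        using h pos[of n] by (intro nn_integral_eq_integral) auto
      also have "\<dots> = 1"
        using pos[of n] by (simp add: mass_def)
      finally show ?thesis
        by (intro real_distribution.intro prob_spaceI real_distribution_axioms.intro) (simp_all add: P_def)
    qed
    have "tight P"
      unfolding tight_def
    proof (intro conjI allI impI P_prob)
      fix \<epsilon> :: real assume \<epsilon>: "\<epsilon> > 0"
      \<comment> \<open>Half-open intervals as in \<open>tight\<close>: the left end point must stay below \<open>0\<close>.\<close>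
      have "measure (P n) {-1<..2*pi} = 1" for n
      proof -
        interpret Pn: real_distribution "P n" by (rule P_prob)
        have "AE x in P n. x \<in> {-1<..2*pi}"
          unfolding P_def by (subst AE_density) (simp, rule eventually_mono[OF AE_mu_fundamental], auto)
        then show ?thesis by (subst Pn.prob_eq_1) auto
      qed
      then show "\<exists>a b. a < b \<and> (\<forall>n. 1 - \<epsilon> < measure (P n) {a<..b})"
        using \<epsilon> by (intro exI[of _ "-1"] exI[of _ "2*pi"]) (auto intro: less_trans[of _ 0])
    qed
    from tight_imp_convergent_subsubsequence[OF this strict_mono_id]
    obtain r Q where r: "strict_mono r" and Q: "real_distribution Q" and conv: "weak_conv_m (P \<circ> r) Q"
      by (auto simp: o_def)
    interpret Q: real_distribution Q by (rule Q)
    have Q_coeff: "(\<integral>x. e (- m) x \<partial>Q) = u m / s" for m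
    proof -
      have "(\<lambda>n. \<integral>x. e (- m) x \<partial>(P \<circ> r) n) \<longlonglongrightarrow> (\<integral>x. e (- m) x \<partial>Q)"
        by (rule weak_conv_imp_integral_bdd_continuous_conv[OF _ Q conv isCont_e, where B=1])
           (simp_all add: P_prob)
      moreover have "(\<lambda>n. \<integral>x. e (- m) x \<partial>P n) \<longlonglongrightarrow> u m / s"
      proof -
        have "(\<integral>x. e (- m) x \<partial>P n) = (\<integral>x. e (- m) x * complex_of_real (h (n + N) x) \<partial>mu) / mass (n + N)" for n
        proof -
          have "(\<integral>x. e (- m) x \<partial>P n) = (\<integral>x. (h (n + N) x / mass (n + N)) *\<^sub>R e (- m) x \<partial>mu)"
            unfolding P_def using h pos[of n] by (subst integral_density) auto
          also have "\<dots> = (\<integral>x. e (- m) x * complex_of_real (h (n + N) x) / mass (n + N) \<partial>mu)"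
            by (simp add: scaleR_conv_of_real mult.commute)
          finally show ?thesis by simp
        qed
        moreover have "(\<lambda>n. (\<integral>x. e (- m) x * complex_of_real (h (n + N) x) \<partial>mu) / complex_of_real (mass (n + N))) \<longlonglongrightarrow> u m / complex_of_real s"
          using s_pos by (intro tendsto_divide tendsto_of_real LIMSEQ_ignore_initial_segment coeff mass_lim) auto
        ultimately show ?thesis by simp
      qed
      then have "(\<lambda>n. \<integral>x. e (- m) x \<partial>(P \<circ> r) n) \<longlonglongrightarrow> u m / s"
        using LIMSEQ_subseq_LIMSEQ[OF _ r] by (simp add: o_def)
      ultimately show ?thesis by (rule LIMSEQ_unique)
    qed
    define M where "M = density (distr Q borel wrap) (\<lambda>_. ennreal s)"
    have "(\<integral>x. e (- m) x \<partial>M) = u m" for m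
    proof -
      have "(\<integral>x. e (- m) x \<partial>M) = (\<integral>x. s *\<^sub>R e (- m) x \<partial>distr Q borel wrap)"
        unfolding M_def using s by (subst integral_density) auto
      also have "\<dots> = (\<integral>x. s *\<^sub>R e (- m) (wrap x) \<partial>Q)"
        by (subst integral_distr) auto
      also have "\<dots> = s *\<^sub>R (\<integral>x. e (- m) x \<partial>Q)"
        by (simp add: periodic_wrap periodic_e)
      finally show ?thesis using s_pos by (simp add: Q_coeff scaleR_conv_of_real)
    qed
    moreover have "circle_measure M"
    proof -
      have em: "emeasure M A = ennreal s * emeasure Q (wrap -` A)" if "A \<in> sets borel" for A
        using that by (simp add: M_def emeasure_density nn_integral_cmult_indicator emeasure_distr)
      have "wrap -` (- {0..<2*pi}) = {}" using wrap_in by auto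
      then have "emeasure M (- {0..<2*pi}) = 0" by (subst em) auto
      moreover have "emeasure M (space M) \<noteq> \<infinity>"
        using em[of UNIV] by (simp add: M_def ennreal_mult_eq_top_iff)
      ultimately show ?thesis
        unfolding circle_measure_def by (intro conjI finite_measureI) (simp_all add: M_def)
    qed
    ultimately show ?thesis by blast
  qed
qed

section \<open>Unconditional sums over the integers\<close>

lemma has_sum_shift_int:
  fixes f :: "int \<Rightarrow> 'a::{comm_monoid_add, topological_space}"
  shows "((\<lambda>k. f (k + j)) has_sum S) UNIV \<longleftrightarrow> (f has_sum S) UNIV"
  by (rule has_sum_reindex_bij_witness[of UNIV "\<lambda>k. k - j" "\<lambda>k. k + j"]) auto

lemma has_sum_reflect_int:
  fixes f :: "int \<Rightarrow> 'a::{comm_monoid_add, topological_space}"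
  shows "((\<lambda>k. f (j - k)) has_sum S) UNIV \<longleftrightarrow> (f has_sum S) UNIV"
  by (rule has_sum_reindex_bij_witness[of UNIV "\<lambda>k. j - k" "\<lambda>k. j - k"]) auto

lemma summable_on_shift_int:
  fixes f :: "int \<Rightarrow> 'a::{comm_monoid_add, topological_space}"
  shows "(\<lambda>k. f (k + j)) summable_on UNIV \<longleftrightarrow> f summable_on UNIV"
  by (rule summable_on_reindex_bij_witness[of UNIV "\<lambda>k. k - j" "\<lambda>k. k + j"]) auto

lemma summable_on_reflect_int:
  fixes f :: "int \<Rightarrow> 'a::{comm_monoid_add, topological_space}"
  shows "(\<lambda>k. f (j - k)) summable_on UNIV \<longleftrightarrow> f summable_on UNIV"
  by (rule summable_on_reindex_bij_witness[of UNIV "\<lambda>k. j - k" "\<lambda>k. j - k"]) auto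

lemma has_sum_diff:
  fixes f g :: "'b \<Rightarrow> 'a::topological_ab_group_add"
  assumes "(f has_sum a) A" "(g has_sum b) A"
  shows "((\<lambda>x. f x - g x) has_sum (a - b)) A"
proof -
  have "((\<lambda>x. - g x) has_sum (- b)) A"
    using assms(2) by (simp add: has_sum_uminus)
  from has_sum_add[OF assms(1) this] show ?thesis by simp
qed

text \<open>
  Reorder the absolutely convergent double series of \<open>x j * y k\<close> along the diagonals \<open>k = j + n\<close>.
\<close>

lemma correlation_has_sum:
  fixes x y :: "int \<Rightarrow> 'a::{real_normed_field, banach}"
  assumes x: "(\<lambda>j. norm (x j)) summable_on UNIV" and y: "(\<lambda>j. norm (y j)) summable_on UNIV"
  shows "(\<lambda>j. norm (x j * y (j + n))) summable_on UNIV"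
    and "((\<lambda>n. \<Sum>\<^sub>\<infinity>j. x j * y (j + n)) has_sum ((\<Sum>\<^sub>\<infinity>j. x j) * (\<Sum>\<^sub>\<infinity>j. y j))) UNIV"
proof -
  define Y where "Y = (\<Sum>\<^sub>\<infinity>j. norm (y j))"
  have Y: "norm (y k) \<le> Y" for k
    using finite_sum_le_infsum[OF y, of "{k}"] by (simp add: Y_def)
  show 1: "(\<lambda>j. norm (x j * y (j + n))) summable_on UNIV" for n
  proof (rule Infinite_Sum.abs_summable_on_comparison_test')
    show "(\<lambda>j. norm (x j) * Y) summable_on UNIV" by (rule summable_on_cmult_left[OF x])
    show "norm (x j * y (j + n)) \<le> norm (x j) * Y" for j
      by (simp add: norm_mult mult_left_mono Y)
  qed
  have xs: "(x has_sum infsum x UNIV) UNIV" and ys: "(y has_sum infsum y UNIV) UNIV"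
    using x y by (auto intro!: has_sum_infsum[OF abs_summable_summable])
  have nx: "((\<lambda>j. norm (x j)) has_sum (\<Sum>\<^sub>\<infinity>j. norm (x j))) UNIV"
    and ny: "((\<lambda>j. norm (y j)) has_sum (\<Sum>\<^sub>\<infinity>j. norm (y j))) UNIV"
    using x y by (auto intro!: has_sum_infsum)
  have "(\<lambda>(j, k). norm (x j) * norm (y k)) summable_on UNIV \<times> UNIV"
  proof (rule summable_on_SigmaI)
    show "((\<lambda>k. case (j, k) of (j, k) \<Rightarrow> norm (x j) * norm (y k)) has_sum norm (x j) * (\<Sum>\<^sub>\<infinity>j. norm (y j))) UNIV" for j
      using has_sum_cmult_right[OF ny, of "norm (x j)"] by simp
    show "(\<lambda>j. norm (x j) * (\<Sum>\<^sub>\<infinity>j. norm (y j))) summable_on UNIV"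
      by (rule summable_on_cmult_left[OF x])
  qed auto
  then have "(\<lambda>p. norm (case p of (j, k) \<Rightarrow> x j * y k)) summable_on UNIV \<times> UNIV"
    by (simp add: norm_mult case_prod_unfold)
  then have sm: "(\<lambda>(j, k). x j * y k) summable_on UNIV \<times> UNIV"
    by (rule abs_summable_summable)
  have "((\<lambda>(j, k). x j * y k) has_sum (infsum x UNIV * infsum y UNIV)) (UNIV \<times> UNIV)"
  proof (rule has_sum_SigmaI[OF _ _ sm])
    show "((\<lambda>k. case (j, k) of (j, k) \<Rightarrow> x j * y k) has_sum x j * infsum y UNIV) UNIV" for j
      using has_sum_cmult_right[OF ys, of "x j"] by simp
    show "((\<lambda>j. x j * infsum y UNIV) has_sum infsum x UNIV * infsum y UNIV) UNIV"
      by (rule has_sum_cmult_left[OF xs])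
  qed
  then have "((\<lambda>(n, j). x j * y (j + n)) has_sum (infsum x UNIV * infsum y UNIV)) (UNIV \<times> UNIV)"
    by (subst has_sum_reindex_bij_witness[of _ "\<lambda>(j, k). (k - j, j)" "\<lambda>(n, j). (j, j + n)" "UNIV \<times> UNIV"
        "\<lambda>(j, k). x j * y k"]) auto
  then show "((\<lambda>n. \<Sum>\<^sub>\<infinity>j. x j * y (j + n)) has_sum (infsum x UNIV * infsum y UNIV)) UNIV"
  proof (rule has_sum_SigmaD)
    show "((\<lambda>j. case (n, j) of (n, j) \<Rightarrow> x j * y (j + n)) has_sum (\<Sum>\<^sub>\<infinity>j. x j * y (j + n))) UNIV" for n
      using has_sum_infsum[OF abs_summable_summable[OF 1[of n]]] by simp
  qed
qed

text \<open>
  Dominated convergence for unconditional sums along an arbitrary filter, as needed for the filter of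
  long intervals.
\<close>

lemma tendsto_infsum_dominated:
  fixes f :: "'i \<Rightarrow> 'b \<Rightarrow> 'a::banach"
  assumes lim: "\<And>x. ((\<lambda>i. f i x) \<longlongrightarrow> g x) F"
    and bound: "\<And>i x. norm (f i x) \<le> b x" and b: "b summable_on UNIV" and F: "F \<noteq> bot"
  shows "((\<lambda>i. \<Sum>\<^sub>\<infinity>x. f i x) \<longlongrightarrow> (\<Sum>\<^sub>\<infinity>x. g x)) F"
proof (rule tendstoI)
  fix \<eta> :: real assume \<eta>: "\<eta> > 0"
  have g: "norm (g x) \<le> b x" for x
    by (rule tendsto_upperbound[OF tendsto_norm[OF lim[of x]] _ F]) (simp add: bound)
  have fs: "(\<lambda>x. f i x) summable_on UNIV" for i
    by (rule abs_summable_summable[OF Infinite_Sum.abs_summable_on_comparison_test'[OF b bound]])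
  have gs: "g summable_on UNIV"
    by (rule abs_summable_summable[OF Infinite_Sum.abs_summable_on_comparison_test'[OF b g]])
  obtain X where X: "finite X" "dist (sum b X) (infsum b UNIV) \<le> \<eta> / 4"
    using has_sum_finite_approximation[OF has_sum_infsum[OF b], of "\<eta> / 4"] \<eta> by auto
  have bX: "b summable_on - X" using b by (rule summable_on_subset) auto
  have "infsum b UNIV = sum b X + infsum b (- X)"
    using infsum_Un_disjoint[of b X "- X"] X(1) bX by simp
  moreover have "infsum b UNIV - sum b X \<le> dist (sum b X) (infsum b UNIV)"
    by (simp add: dist_real_def)
  ultimately have tail: "infsum b (- X) \<le> \<eta> / 4"
    using X(2) by linarith
  have "((\<lambda>i. \<Sum>x\<in>X. norm (f i x - g x)) \<longlongrightarrow> (\<Sum>x\<in>X. norm (g x - g x))) F"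
    by (intro tendsto_intros lim)
  then have "\<forall>\<^sub>F i in F. (\<Sum>x\<in>X. norm (f i x - g x)) < \<eta> / 2"
    by (rule order_tendstoD) (use \<eta> in simp)
  then show "\<forall>\<^sub>F i in F. dist (\<Sum>\<^sub>\<infinity>x. f i x) (\<Sum>\<^sub>\<infinity>x. g x) < \<eta>"
  proof eventually_elim
    case (elim i)
    define D where "D x = norm (f i x - g x)" for x
    have D_le: "D x \<le> 2 * b x" for x
      using norm_triangle_ineq4[of "f i x" "g x"] bound[of i x] g[of x] by (simp add: D_def)
    have D_nonneg: "0 \<le> D x" for x by (simp add: D_def)
    have "(\<lambda>x. 2 * b x) summable_on UNIV" by (rule summable_on_cmult_right[OF b])
    then have Ds: "D summable_on UNIV"
      by (rule summable_on_comparison_test) (use D_le D_nonneg in auto)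
    have DX: "D summable_on - X" using Ds by (rule summable_on_subset) auto
    have "dist (\<Sum>\<^sub>\<infinity>x. f i x) (\<Sum>\<^sub>\<infinity>x. g x) = norm (\<Sum>\<^sub>\<infinity>x. f i x - g x)"
      using infsumI[OF has_sum_diff[OF has_sum_infsum[OF fs[of i]] has_sum_infsum[OF gs]]] by (simp add: dist_norm)
    also have "\<dots> \<le> infsum D UNIV"
      using Ds unfolding D_def by (rule norm_infsum_bound)
    also have "\<dots> = sum D X + infsum D (- X)"
      using infsum_Un_disjoint[of D X "- X"] X(1) DX by simp
    also have "infsum D (- X) \<le> infsum (\<lambda>x. 2 * b x) (- X)"
      by (rule infsum_mono[OF DX summable_on_cmult_right[OF bX]]) (rule D_le)
    also have "\<dots> = 2 * infsum b (- X)"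
      by (rule infsum_cmult_right) (rule bX)
    finally show ?case
      using tail elim \<eta> by (simp add: D_def)
  qed
qed

section \<open>Mean values of the products of the symbol coefficients\<close>

lemma eventually_long_intervals:
  "eventually P long_intervals \<longleftrightarrow> (\<exists>N. \<forall>p q. card {p..q::int} \<ge> N \<longrightarrow> P {p..q})"
proof -
  have "eventually P long_intervals \<longleftrightarrow>
      (\<exists>Q. (\<exists>N. \<forall>n\<ge>N. Q n) \<and> (\<forall>I. Q (card I) \<longrightarrow> I \<in> {I. \<exists>p q. I = {p..q}} \<longrightarrow> P I))"
    unfolding long_intervals_def eventually_inf_principal eventually_filtercomap eventually_at_top_linorder ..
  also have "\<dots> \<longleftrightarrow> (\<exists>N. \<forall>p q. card {p..q::int} \<ge> N \<longrightarrow> P {p..q})"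
  proof
    assume "\<exists>Q. (\<exists>N. \<forall>n\<ge>N. Q n) \<and> (\<forall>I. Q (card I) \<longrightarrow> I \<in> {I. \<exists>p q. I = {p..q}} \<longrightarrow> P I)"
    then obtain Q N where "\<And>n. n \<ge> N \<Longrightarrow> Q n" "\<And>p q. Q (card {p..q}) \<Longrightarrow> P {p..q}"
      by blast
    then show "\<exists>N. \<forall>p q. card {p..q::int} \<ge> N \<longrightarrow> P {p..q}"
      by blast
  next
    assume "\<exists>N. \<forall>p q. card {p..q::int} \<ge> N \<longrightarrow> P {p..q}"
    then obtain N where "\<And>p q. card {p..q::int} \<ge> N \<Longrightarrow> P {p..q}"
      by blast
    then show "\<exists>Q. (\<exists>N. \<forall>n\<ge>N. Q n) \<and> (\<forall>I. Q (card I) \<longrightarrow> I \<in> {I. \<exists>p q. I = {p..q}} \<longrightarrow> P I)"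
      by (intro exI[of _ "\<lambda>n. n \<ge> N"]) auto
  qed
  finally show ?thesis .
qed

lemma long_intervals_nontrivial: "long_intervals \<noteq> bot"
proof
  assume "long_intervals = bot"
  then have "eventually (\<lambda>_. False) long_intervals" by simp
  then obtain N where "\<And>p q. card {p..q::int} \<ge> N \<Longrightarrow> False"
    unfolding eventually_long_intervals by blast
  from this[of 1 "int N"] show False by simp
qed

lemma DT_coeff_bound:
  assumes "diagonal_type W"
  shows "cmod (op_mat W j k) \<le> DT_coeff W (j - k)"
proof -
  have "cmod (op_mat W (k + (j - k)) k) \<le> DT_coeff W (j - k)"
    unfolding DT_coeff_def using assms by (intro cSUP_upper) (auto simp: diagonal_type_def)
  then show ?thesis by simp
qed

lemma DT_coeff_nonneg: "diagonal_type W \<Longrightarrow> 0 \<le> DT_coeff W k"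
  using order_trans[OF norm_ge_zero DT_coeff_bound[of W k 0]] by simp

lemma DT_coeff_summable: "diagonal_type W \<Longrightarrow> DT_coeff W summable_on UNIV"
  by (simp add: diagonal_type_def)

lemma DT_norm_nonneg: "diagonal_type W \<Longrightarrow> 0 \<le> DT_norm W"
  unfolding DT_norm_def by (intro infsum_nonneg DT_coeff_nonneg)

lemma op_mat_row_summable:
  assumes "diagonal_type W"
  shows "(\<lambda>k. cmod (op_mat W j k * e (j - k) a)) summable_on UNIV"
proof (rule Infinite_Sum.abs_summable_on_comparison_test')
  show "(\<lambda>k. DT_coeff W (j - k)) summable_on UNIV"
    using DT_coeff_summable[OF assms] by (simp add: summable_on_reflect_int)
  show "cmod (op_mat W j k * e (j - k) a) \<le> DT_coeff W (j - k)" for k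
    using DT_coeff_bound[OF assms] by (simp add: norm_mult)
qed

lemma w_coeff_bound:
  assumes "diagonal_type W"
  shows "cmod (w_coeff W j a) \<le> DT_norm W"
proof (rule norm_infsum_le)
  show "((\<lambda>k. op_mat W j k * e (j - k) a) has_sum w_coeff W j a) UNIV"
    unfolding w_coeff_def by (rule has_sum_infsum[OF abs_summable_summable[OF op_mat_row_summable[OF assms]]])
  show "((\<lambda>k. DT_coeff W (j - k)) has_sum DT_norm W) UNIV"
    using has_sum_infsum[OF DT_coeff_summable[OF assms]] by (simp add: has_sum_reflect_int DT_norm_def)
  show "cmod (op_mat W j k * e (j - k) a) \<le> DT_coeff W (j - k)" for k
    using DT_coeff_bound[OF assms] by (simp add: norm_mult)
qed

text \<open>
  The inner product of row \<open>l + m\<close> of the matrix of \<open>W\<close> with the shift by \<open>n\<close> of row \<open>l\<close>;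
  \<open>corr_avg W m n I\<close> is its average over \<open>l\<close> in \<open>I\<close>.
\<close>

definition row_corr :: "((real \<Rightarrow> complex) \<Rightarrow> (real \<Rightarrow> complex)) \<Rightarrow> int \<Rightarrow> int \<Rightarrow> int \<Rightarrow> complex" where
  "row_corr W m n l = (\<Sum>\<^sub>\<infinity>j. op_mat W (l + m) j * cnj (op_mat W l (j + n)))"

text \<open>
  The autocorrelation of \<open>DT_coeff W\<close>. Its value at \<open>m + n\<close> bounds \<open>row_corr W m n l\<close>
  for every \<open>l\<close>, and it is summable, with sum \<open>(DT_norm W)\<^sup>2\<close>.
\<close>

definition DT_corr :: "((real \<Rightarrow> complex) \<Rightarrow> (real \<Rightarrow> complex)) \<Rightarrow> int \<Rightarrow> real" where
  "DT_corr W n = (\<Sum>\<^sub>\<infinity>i. DT_coeff W i * DT_coeff W (i + n))"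

lemma DT_corr_terms_summable:
  assumes "diagonal_type W"
  shows "(\<lambda>i. DT_coeff W i * DT_coeff W (i + n)) summable_on UNIV"
  using correlation_has_sum(1)[of "DT_coeff W" "DT_coeff W" n] DT_coeff_summable[OF assms] DT_coeff_nonneg[OF assms]
  by (simp add: abs_mult)

lemma DT_corr_summable:
  assumes "diagonal_type W"
  shows "DT_corr W summable_on UNIV"
  using correlation_has_sum(2)[of "DT_coeff W" "DT_coeff W"] DT_coeff_summable[OF assms] DT_coeff_nonneg[OF assms]
  by (auto simp: DT_corr_def[abs_def] summable_on_def)

lemma row_corr_bound:
  assumes W: "diagonal_type W"
  shows "cmod (row_corr W m n l) \<le> DT_corr W (m + n)"
proof -
  define b where "b j = DT_coeff W (l + m - j) * DT_coeff W (l - (j + n))" for j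
  have le: "cmod (op_mat W (l + m) j * cnj (op_mat W l (j + n))) \<le> b j" for j
    unfolding b_def norm_mult complex_mod_cnj
    by (intro mult_mono DT_coeff_bound W DT_coeff_nonneg norm_ge_zero)
  have "((\<lambda>i. DT_coeff W i * DT_coeff W (i + (m + n))) has_sum DT_corr W (m + n)) UNIV"
    unfolding DT_corr_def by (rule has_sum_infsum[OF DT_corr_terms_summable[OF W]])
  then have "((\<lambda>j. DT_coeff W (l - n - j) * DT_coeff W (l - n - j + (m + n))) has_sum DT_corr W (m + n)) UNIV"
    by (subst has_sum_reflect_int)
  moreover have "DT_coeff W (l - n - j) * DT_coeff W (l - n - j + (m + n)) = b j" for j
    by (simp add: b_def algebra_simps)
  ultimately have b: "(b has_sum DT_corr W (m + n)) UNIV" by simp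
  have "(\<lambda>j. cmod (op_mat W (l + m) j * cnj (op_mat W l (j + n)))) summable_on UNIV"
    by (rule Infinite_Sum.abs_summable_on_comparison_test'[OF has_sum_imp_summable[OF b] le])
  then have "((\<lambda>j. op_mat W (l + m) j * cnj (op_mat W l (j + n))) has_sum row_corr W m n l) UNIV"
    unfolding row_corr_def by (rule has_sum_infsum[OF abs_summable_summable])
  from norm_infsum_le[OF this b le] show ?thesis .
qed

text \<open>
  Expand both factors and collect the terms with the same difference \<open>n\<close> of column indices: the
  exponentials then combine to the common factor \<open>e (m + n) a\<close>.
\<close>

lemma w_coeff_product_has_sum:
  assumes W: "diagonal_type W"
  shows "((\<lambda>n. row_corr W m n l * e (m + n) a) has_sum (w_coeff W (l + m) a * cnj (w_coeff W l a))) UNIV"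
proof -
  define x where "x j = op_mat W (l + m) j * e (l + m - j) a" for j
  define y where "y k = cnj (op_mat W l k * e (l - k) a)" for k
  have "((\<lambda>n. \<Sum>\<^sub>\<infinity>j. x j * y (j + n)) has_sum ((\<Sum>\<^sub>\<infinity>j. x j) * (\<Sum>\<^sub>\<infinity>j. y j))) UNIV"
    using op_mat_row_summable[OF W, of "l + m" a] op_mat_row_summable[OF W, of l a]
    by (intro correlation_has_sum) (simp_all add: x_def[abs_def] y_def[abs_def] complex_mod_cnj del: complex_cnj_mult)
  moreover have "(\<Sum>\<^sub>\<infinity>j. x j * y (j + n)) = row_corr W m n l * e (m + n) a" for n
  proof -
    have "x j * y (j + n) = op_mat W (l + m) j * cnj (op_mat W l (j + n)) * e (m + n) a" for j
    proof -
      have "e (l + m - j) a * e (- (l - (j + n))) a = e (m + n) a"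
        by (simp add: e_add algebra_simps)
      then show ?thesis
        by (simp add: x_def y_def cnj_e mult_ac)
    qed
    then show ?thesis by (simp add: row_corr_def infsum_cmult_left')
  qed
  moreover have "(\<Sum>\<^sub>\<infinity>j. x j) = w_coeff W (l + m) a" "(\<Sum>\<^sub>\<infinity>j. y j) = cnj (w_coeff W l a)"
    unfolding x_def y_def w_coeff_def by (simp_all del: complex_cnj_mult)
  ultimately show ?thesis by simp
qed

lemma has_sum_finite_sum:
  fixes f :: "'i \<Rightarrow> 'b \<Rightarrow> 'a::topological_comm_monoid_add"
  assumes "\<And>i. i \<in> I \<Longrightarrow> (f i has_sum s i) A"
  shows "((\<lambda>x. \<Sum>i\<in>I. f i x) has_sum (\<Sum>i\<in>I. s i)) A"
  using assms by (induction I rule: infinite_finite_induct) (auto intro: has_sum_add)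

lemma w_coeff_product_average:
  assumes W: "diagonal_type W"
  shows "(\<Sum>l\<in>I. w_coeff W (l + m) a * cnj (w_coeff W l a)) / of_nat (card I)
    = (\<Sum>\<^sub>\<infinity>n. corr_avg W m n I * e (m + n) a)"
proof -
  have "((\<lambda>n. \<Sum>l\<in>I. row_corr W m n l * e (m + n) a) has_sum (\<Sum>l\<in>I. w_coeff W (l + m) a * cnj (w_coeff W l a))) UNIV"
    by (intro has_sum_finite_sum w_coeff_product_has_sum W)
  from has_sum_cmult_left[OF this, of "inverse (of_nat (card I))"]
  have "((\<lambda>n. corr_avg W m n I * e (m + n) a) has_sum
      ((\<Sum>l\<in>I. w_coeff W (l + m) a * cnj (w_coeff W l a)) / of_nat (card I))) UNIV"
    by (simp add: corr_avg_def row_corr_def[symmetric] sum_distrib_left[symmetric] divide_inverse mult_ac)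
  then show ?thesis by (rule infsumI[symmetric])
qed

lemma corr_avg_bound:
  assumes W: "diagonal_type W"
  shows "cmod (corr_avg W m n I) \<le> DT_corr W (m + n)"
proof (cases "card I = 0")
  case True
  then show ?thesis
    using order_trans[OF norm_ge_zero row_corr_bound[OF W]] by (simp add: corr_avg_def)
next
  case False
  have "cmod (\<Sum>l\<in>I. row_corr W m n l) \<le> of_nat (card I) * DT_corr W (m + n)"
    by (intro sum_norm_bound row_corr_bound W)
  then show ?thesis
    using False by (simp add: corr_avg_def row_corr_def[symmetric] norm_divide divide_simps mult.commute)
qed

text \<open>
  Regularity gives the limit of the averages for every fixed \<open>n\<close>, and \<open>DT_corr W\<close> dominates, so the
  limit may be taken inside the sum over \<open>n\<close>.
\<close>

theorem w_coeff_product_mean: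
  assumes "regular_operator W"
  shows "((\<lambda>I. (\<Sum>l\<in>I. w_coeff W (l + m) a * cnj (w_coeff W l a)) / of_nat (card I)) \<longlongrightarrow> v_coeff W m a)
    long_intervals"
  unfolding v_coeff_def
proof -
  have W: "diagonal_type W" using assms by (simp add: regular_operator_def)
  have "(corr_avg W m n \<longlongrightarrow> omega W m n) long_intervals" for n
    using assms tendsto_Lim[OF long_intervals_nontrivial] unfolding regular_operator_def omega_def by metis
  then show "((\<lambda>I. (\<Sum>l\<in>I. w_coeff W (l + m) a * cnj (w_coeff W l a)) / of_nat (card I))
      \<longlongrightarrow> (\<Sum>\<^sub>\<infinity>n. omega W m n * e (m + n) a)) long_intervals"
    unfolding w_coeff_product_average[OF W]
  proof (intro tendsto_infsum_dominated[where b="\<lambda>n. DT_corr W (m + n)"] tendsto_mult_right long_intervals_nontrivial)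
    show "cmod (corr_avg W m n I * e (m + n) a) \<le> DT_corr W (m + n)" for n I
      using corr_avg_bound[OF W] by (simp add: norm_mult)
    show "(\<lambda>n. DT_corr W (m + n)) summable_on UNIV"
      using DT_corr_summable[OF W] summable_on_shift_int[of "DT_corr W" m] by (simp add: add.commute)
  qed
qed

section \<open>Coefficient sequences of concentrated functions\<close>

text \<open>
  The weights are balanced for \<open>q\<close> of size \<open>\<epsilon>\<close> and \<open>x\<close> of size \<open>1\<close>: both terms of the bound are then of
  size \<open>\<epsilon>\<close>, and they can be summed separately. This takes the place of the Cauchy--Schwarz inequality for
  series.
\<close>

lemma weighted_Young:
  fixes q x \<epsilon> :: real
  assumes "\<epsilon> > 0"
  shows "q * x \<le> (q\<^sup>2 / \<epsilon> + \<epsilon> * x\<^sup>2) / 2"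
proof -
  have "2 * (q * (\<epsilon> * x)) \<le> q\<^sup>2 + (\<epsilon> * x)\<^sup>2"
    using sum_squares_bound[of q "\<epsilon> * x"] by (simp add: mult.assoc)
  then have "\<epsilon> * (2 * (q * x)) \<le> \<epsilon> * (q\<^sup>2 / \<epsilon> + \<epsilon> * x\<^sup>2)"
    using assms by (simp add: algebra_simps power2_eq_square)
  then show ?thesis using assms by simp
qed

text \<open>
  What the coefficients \<open>p\<close> of a unit vector supported in an arc of radius \<open>\<epsilon>\<close> around \<open>a\<close>
  satisfy with \<open>z m = e (- m) a\<close>: a shift by \<open>m\<close> is multiplication by \<open>z m\<close> up to an error of norm
  \<open>\<bar>m\<bar> \<epsilon>\<close>.
\<close>

locale concentrated_coefficients =
  fixes p :: "int \<Rightarrow> complex" and z :: "int \<Rightarrow> complex" and \<epsilon> :: real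
  assumes eps: "\<epsilon> > 0"
    and unit: "((\<lambda>k. (cmod (p k))\<^sup>2) has_sum 1) UNIV"
    and z: "\<And>m. cmod (z m) = 1"
    and defect_summable: "\<And>m. (\<lambda>k. (cmod (p (k + m) - z m * p k))\<^sup>2) summable_on UNIV"
    and defect_le: "\<And>m. (\<Sum>\<^sub>\<infinity>k. (cmod (p (k + m) - z m * p k))\<^sup>2) \<le> (of_int m * \<epsilon>)\<^sup>2"
begin

lemma weighted_summable:
  assumes "\<And>k. cmod (G k) \<le> B"
  shows "(\<lambda>k. G k * complex_of_real ((cmod (p k))\<^sup>2)) summable_on UNIV"
proof (rule abs_summable_summable)
  show "(\<lambda>k. cmod (G k * complex_of_real ((cmod (p k))\<^sup>2))) summable_on UNIV"
  proof (rule Infinite_Sum.abs_summable_on_comparison_test')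
    show "(\<lambda>k. B * (cmod (p k))\<^sup>2) summable_on UNIV"
      by (rule summable_on_cmult_right[OF has_sum_imp_summable[OF unit]])
    show "cmod (G k * complex_of_real ((cmod (p k))\<^sup>2)) \<le> B * (cmod (p k))\<^sup>2" for k
      using assms by (simp add: norm_mult mult_right_mono norm_power)
  qed
qed

text \<open>
  The common form of the error terms below: summed over \<open>k\<close>, the squared defect contributes
  \<open>m\<^sup>2 \<epsilon>\<close> and the two squares of coefficients contribute \<open>\<epsilon>\<close>.
\<close>

lemma defect_bound:
  fixes d :: "int \<Rightarrow> complex"
  assumes B: "B \<ge> 0"
    and d: "\<And>k. cmod (d k) \<le> B * ((cmod (p (k + m) - z m * p k))\<^sup>2 / \<epsilon> + \<epsilon> * ((cmod (p k))\<^sup>2 + (cmod (p (k + m)))\<^sup>2) / 2)"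
    and s: "(d has_sum s) UNIV"
  shows "cmod s \<le> B * ((of_int m)\<^sup>2 + 1) * \<epsilon>"
proof -
  define Q where "Q = (\<Sum>\<^sub>\<infinity>k. (cmod (p (k + m) - z m * p k))\<^sup>2)"
  have shift: "((\<lambda>k. (cmod (p (k + m)))\<^sup>2) has_sum 1) UNIV"
    using unit by (simp add: has_sum_shift_int[of "\<lambda>k. (cmod (p k))\<^sup>2"])
  have "((\<lambda>k. (cmod (p (k + m) - z m * p k))\<^sup>2 * (1 / \<epsilon>) + (\<epsilon> / 2) * ((cmod (p k))\<^sup>2 + (cmod (p (k + m)))\<^sup>2))
      has_sum (Q * (1 / \<epsilon>) + (\<epsilon> / 2) * (1 + 1))) UNIV"
    unfolding Q_def
    by (intro has_sum_add has_sum_cmult_left has_sum_cmult_right unit shift has_sum_infsum defect_summable)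
  from has_sum_cmult_right[OF this, of B]
  have "((\<lambda>k. B * ((cmod (p (k + m) - z m * p k))\<^sup>2 / \<epsilon> + \<epsilon> * ((cmod (p k))\<^sup>2 + (cmod (p (k + m)))\<^sup>2) / 2))
      has_sum (B * (Q / \<epsilon> + \<epsilon>))) UNIV"
    by simp
  from norm_infsum_le[OF s this d] have "cmod s \<le> B * (Q / \<epsilon> + \<epsilon>)" .
  also have "Q / \<epsilon> \<le> (of_int m)\<^sup>2 * \<epsilon>"
    using defect_le[of m] eps by (simp add: Q_def divide_simps power2_eq_square mult_ac)
  then have "B * (Q / \<epsilon> + \<epsilon>) \<le> B * (((of_int m)\<^sup>2 + 1) * \<epsilon>)"
    by (intro mult_left_mono B) (simp add: distrib_right)
  finally show ?thesis by (simp only: mult.assoc)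
qed

text \<open>
  The weights \<open>\<bar>p\<^sub>k\<bar>\<^sup>2\<close> are almost invariant under a shift, since \<open>z m\<close> has modulus one and drops out
  of \<open>\<bar>p\<^sub>k\<^sub>+\<^sub>m\<bar>\<^sup>2\<close>.
\<close>

lemma weighted_shift:
  assumes G: "\<And>k. cmod (G k) \<le> B"
  shows "cmod ((\<Sum>\<^sub>\<infinity>k. G k * complex_of_real ((cmod (p k))\<^sup>2)) - (\<Sum>\<^sub>\<infinity>k. G (k + m) * complex_of_real ((cmod (p k))\<^sup>2)))
    \<le> B * ((of_int m)\<^sup>2 + 1) * \<epsilon>"
proof (rule defect_bound)
  show B: "B \<ge> 0" using order_trans[OF norm_ge_zero G[of 0]] .
  let ?d = "\<lambda>k. G (k + m) * complex_of_real ((cmod (p (k + m)))\<^sup>2) - G (k + m) * complex_of_real ((cmod (p k))\<^sup>2)"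
  have "((\<lambda>k. G (k + m) * complex_of_real ((cmod (p (k + m)))\<^sup>2)) has_sum (\<Sum>\<^sub>\<infinity>k. G k * complex_of_real ((cmod (p k))\<^sup>2))) UNIV"
    by (subst has_sum_shift_int[of "\<lambda>k. G k * complex_of_real ((cmod (p k))\<^sup>2)"])
      (rule has_sum_infsum[OF weighted_summable[of G, OF G]])
  then show "(?d has_sum ((\<Sum>\<^sub>\<infinity>k. G k * complex_of_real ((cmod (p k))\<^sup>2)) - (\<Sum>\<^sub>\<infinity>k. G (k + m) * complex_of_real ((cmod (p k))\<^sup>2)))) UNIV"
    by (rule has_sum_diff) (rule has_sum_infsum[OF weighted_summable[of "\<lambda>k. G (k + m)", OF G]])
  fix k
  define x y q where "x = cmod (p (k + m))" and "y = cmod (p k)" and "q = cmod (p (k + m) - z m * p k)"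
  have "\<bar>x - y\<bar> \<le> q"
    using norm_triangle_ineq3[of "p (k + m)" "z m * p k"] by (simp add: x_def y_def q_def norm_mult z)
  moreover have nonneg: "x \<ge> 0" "y \<ge> 0" by (auto simp: x_def y_def)
  ultimately have "\<bar>x - y\<bar> * (x + y) \<le> q * (x + y)"
    by (intro mult_right_mono) auto
  also have "\<dots> \<le> q\<^sup>2 / \<epsilon> + \<epsilon> * (y\<^sup>2 + x\<^sup>2) / 2"
    using weighted_Young[OF eps, of q x] weighted_Young[OF eps, of q y] by (simp add: algebra_simps add_divide_distrib)
  finally have "\<bar>x\<^sup>2 - y\<^sup>2\<bar> \<le> q\<^sup>2 / \<epsilon> + \<epsilon> * (y\<^sup>2 + x\<^sup>2) / 2"
    using nonneg by (simp add: power2_eq_square square_diff_square_factored abs_mult mult.commute)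
  then have "cmod (G (k + m)) * \<bar>x\<^sup>2 - y\<^sup>2\<bar> \<le> B * (q\<^sup>2 / \<epsilon> + \<epsilon> * (y\<^sup>2 + x\<^sup>2) / 2)"
    by (intro mult_mono G B) auto
  moreover have "?d k = G (k + m) * complex_of_real (x\<^sup>2 - y\<^sup>2)"
    by (simp add: x_def y_def right_diff_distrib)
  ultimately show "cmod (?d k) \<le> B * ((cmod (p (k + m) - z m * p k))\<^sup>2 / \<epsilon> + \<epsilon> * ((cmod (p k))\<^sup>2 + (cmod (p (k + m)))\<^sup>2) / 2)"
    unfolding x_def[symmetric] y_def[symmetric] q_def[symmetric] by (simp only: norm_mult norm_of_real)
qed

text \<open>
  By \<open>weighted_shift\<close> the weighted mean of \<open>G\<close> hardly changes if \<open>G\<close> is replaced by its averages over windows of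
  length \<open>N\<close>. These are all close to \<open>v\<close>, and the weights have total mass one.
\<close>

lemma weighted_average:
  assumes G: "\<And>k. cmod (G k) \<le> B" and N: "N > 0"
    and avg: "\<And>k. cmod ((\<Sum>j<N. G (k + int j)) / of_nat N - v) \<le> \<delta>"
  shows "cmod ((\<Sum>\<^sub>\<infinity>k. G k * complex_of_real ((cmod (p k))\<^sup>2)) - v) \<le> \<delta> + B * ((real N)\<^sup>2 + 1) * \<epsilon>"
proof -
  define S where "S j = (\<Sum>\<^sub>\<infinity>k. G (k + j) * complex_of_real ((cmod (p k))\<^sup>2))" for j :: int
  have S: "((\<lambda>k. G (k + j) * complex_of_real ((cmod (p k))\<^sup>2)) has_sum S j) UNIV" for j
    unfolding S_def by (rule has_sum_infsum[OF weighted_summable[of "\<lambda>k. G (k + j)", OF G]])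
  have B: "B \<ge> 0" using order_trans[OF norm_ge_zero G[of 0]] .
  have "cmod (S 0 - S (int j)) \<le> B * ((real N)\<^sup>2 + 1) * \<epsilon>" if "j < N" for j
  proof -
    have "cmod (S 0 - S (int j)) \<le> B * ((real j)\<^sup>2 + 1) * \<epsilon>"
      using weighted_shift[of G, OF G, of "int j"] by (simp add: S_def)
    also have "\<dots> \<le> B * ((real N)\<^sup>2 + 1) * \<epsilon>"
      using that B eps by (intro mult_right_mono mult_left_mono add_right_mono power_mono) auto
    finally show ?thesis .
  qed
  then have "cmod (\<Sum>j<N. S 0 - S (int j)) \<le> real (card {..<N}) * (B * ((real N)\<^sup>2 + 1) * \<epsilon>)"
    by (intro sum_norm_bound) auto
  then have "cmod ((\<Sum>j<N. S 0 - S (int j)) / of_nat N) \<le> B * ((real N)\<^sup>2 + 1) * \<epsilon>"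
    using N by (simp add: norm_divide divide_simps mult_ac)
  moreover have "(\<Sum>j<N. S 0 - S (int j)) / of_nat N = S 0 - (\<Sum>j<N. S (int j)) / of_nat N"
    using N by (simp add: sum_subtractf diff_divide_distrib)
  ultimately have 1: "cmod (S 0 - (\<Sum>j<N. S (int j)) / of_nat N) \<le> B * ((real N)\<^sup>2 + 1) * \<epsilon>"
    by simp
  have "((\<lambda>k. (\<Sum>j<N. G (k + int j) * complex_of_real ((cmod (p k))\<^sup>2)) * (1 / of_nat N)) has_sum ((\<Sum>j<N. S (int j)) * (1 / of_nat N))) UNIV"
    by (intro has_sum_cmult_left has_sum_finite_sum S)
  moreover have "((\<lambda>k. v * complex_of_real ((cmod (p k))\<^sup>2)) has_sum (v * complex_of_real 1)) UNIV"
    by (intro has_sum_cmult_right has_sum_of_real unit)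
  ultimately have d: "((\<lambda>k. (\<Sum>j<N. G (k + int j) * complex_of_real ((cmod (p k))\<^sup>2)) * (1 / of_nat N) - v * complex_of_real ((cmod (p k))\<^sup>2))
      has_sum ((\<Sum>j<N. S (int j)) * (1 / of_nat N) - v * complex_of_real 1)) UNIV"
    by (rule has_sum_diff)
  have "cmod ((\<Sum>j<N. S (int j)) * (1 / of_nat N) - v * complex_of_real 1) \<le> \<delta> * 1"
  proof (rule norm_infsum_le[OF d has_sum_cmult_right[OF unit]])
    fix k
    have "(\<Sum>j<N. G (k + int j) * complex_of_real ((cmod (p k))\<^sup>2)) * (1 / of_nat N) - v * complex_of_real ((cmod (p k))\<^sup>2)
       = ((\<Sum>j<N. G (k + int j)) / of_nat N - v) * complex_of_real ((cmod (p k))\<^sup>2)"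
      by (simp add: sum_distrib_right[symmetric] left_diff_distrib)
    then show "cmod ((\<Sum>j<N. G (k + int j) * complex_of_real ((cmod (p k))\<^sup>2)) * (1 / of_nat N) - v * complex_of_real ((cmod (p k))\<^sup>2)) \<le> \<delta> * (cmod (p k))\<^sup>2"
      using mult_right_mono[OF avg[of k], of "(cmod (p k))\<^sup>2"] by (simp add: norm_mult norm_power)
  qed
  then have 2: "cmod ((\<Sum>j<N. S (int j)) / of_nat N - v) \<le> \<delta>" by simp
  have "cmod (S 0 - v) \<le> cmod (S 0 - (\<Sum>j<N. S (int j)) / of_nat N) + cmod ((\<Sum>j<N. S (int j)) / of_nat N - v)"
    using norm_triangle_ineq[of "S 0 - (\<Sum>j<N. S (int j)) / of_nat N" "(\<Sum>j<N. S (int j)) / of_nat N - v"] by simp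
  with 1 2 show ?thesis by (simp add: S_def)
qed

text \<open>
  Replacing \<open>p\<^sub>k\<^sub>+\<^sub>m\<close> by \<open>z m p\<^sub>k\<close> turns \<open>p\<^sub>k\<^sub>+\<^sub>m cnj p\<^sub>k\<close> into \<open>z m \<bar>p\<^sub>k\<bar>\<^sup>2\<close>.
\<close>

lemma weighted_correlation:
  assumes G: "\<And>k. cmod (G k) \<le> B"
    and s: "((\<lambda>k. G k * (p (k + m) * cnj (p k))) has_sum s) UNIV"
  shows "cmod (s - z m * (\<Sum>\<^sub>\<infinity>k. G k * complex_of_real ((cmod (p k))\<^sup>2))) \<le> B * ((of_int m)\<^sup>2 + 1) * \<epsilon>"
proof (rule defect_bound)
  show B: "B \<ge> 0" using order_trans[OF norm_ge_zero G[of 0]] .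
  let ?d = "\<lambda>k. G k * (p (k + m) * cnj (p k)) - z m * (G k * complex_of_real ((cmod (p k))\<^sup>2))"
  show "(?d has_sum (s - z m * (\<Sum>\<^sub>\<infinity>k. G k * complex_of_real ((cmod (p k))\<^sup>2)))) UNIV"
    by (intro has_sum_diff s has_sum_cmult_right has_sum_infsum weighted_summable[OF G])
  fix k
  define y q where "y = cmod (p k)" and "q = cmod (p (k + m) - z m * p k)"
  have "?d k = G k * ((p (k + m) - z m * p k) * cnj (p k))"
    unfolding cmod_square_eq by (simp add: algebra_simps)
  then have "cmod (?d k) = cmod (G k) * (q * y)"
    by (simp only: norm_mult complex_mod_cnj y_def q_def)
  also have "\<dots> \<le> B * (q\<^sup>2 / \<epsilon> + \<epsilon> * (y\<^sup>2 + (cmod (p (k + m)))\<^sup>2) / 2)"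
  proof (intro mult_mono G B)
    have "q * y \<le> (q\<^sup>2 / \<epsilon> + \<epsilon> * y\<^sup>2) / 2" by (rule weighted_Young[OF eps])
    moreover have "0 \<le> q\<^sup>2 / \<epsilon>" "0 \<le> \<epsilon> * (cmod (p (k + m)))\<^sup>2" using eps by auto
    ultimately show "q * y \<le> q\<^sup>2 / \<epsilon> + \<epsilon> * (y\<^sup>2 + (cmod (p (k + m)))\<^sup>2) / 2"
      by (simp add: distrib_left add_divide_distrib)
  qed (auto simp: q_def y_def)
  finally show "cmod (?d k) \<le> B * ((cmod (p (k + m) - z m * p k))\<^sup>2 / \<epsilon> + \<epsilon> * ((cmod (p k))\<^sup>2 + (cmod (p (k + m)))\<^sup>2) / 2)"
    unfolding y_def q_def .
qed

end

section \<open>Arcs\<close>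

lemma open_arc: "open (arc a r)"
proof -
  have "arc a r = (\<Union>k::int. {x. \<bar>x - a - 2 * pi * of_int k\<bar> < r})"
    by (auto simp: arc_def)
  moreover have "open {x. \<bar>x - a - 2 * pi * of_int k\<bar> < r}" for k :: int
    by (intro open_Collect_less continuous_intros)
  ultimately show ?thesis by auto
qed

lemma arc_measurable [measurable]: "arc a r \<in> sets borel"
  by (rule borel_open[OF open_arc])

lemma arc_periodic: "x + 2 * pi \<in> arc a r \<longleftrightarrow> x \<in> arc a r"
proof
  assume "x + 2 * pi \<in> arc a r"
  then obtain k :: int where "\<bar>x + 2 * pi - a - 2 * pi * of_int k\<bar> < r" by (auto simp: arc_def)
  then show "x \<in> arc a r"
    by (auto simp: arc_def algebra_simps intro!: exI[of _ "k - 1"])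
next
  assume "x \<in> arc a r"
  then obtain k :: int where "\<bar>x - a - 2 * pi * of_int k\<bar> < r" by (auto simp: arc_def)
  then show "x + 2 * pi \<in> arc a r"
    by (auto simp: arc_def algebra_simps intro!: exI[of _ "k + 1"])
qed

lemma measure_arc_pos:
  assumes "r > 0"
  shows "measure mu (arc a r) > 0"
proof -
  define b where "b = wrap a"
  have b: "0 \<le> b" "b < 2 * pi" using wrap_in[of a] by (auto simp: b_def)
  define c where "c = min (b + r) (2 * pi)"
  have c: "b < c" using assms b by (simp add: c_def)
  have sub: "{b<..<c} \<subseteq> {0..<2 * pi} \<inter> arc a r"
  proof
    fix x assume x: "x \<in> {b<..<c}"
    then have "\<bar>x - a - 2 * pi * of_int (- \<lfloor>a / (2 * pi)\<rfloor>)\<bar> < r"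
      by (auto simp: c_def b_def wrap_def)
    then have "x \<in> arc a r" unfolding arc_def by blast
    then show "x \<in> {0..<2 * pi} \<inter> arc a r" using x b by (auto simp: c_def)
  qed
  have "0 < measure lborel {b<..<c}" using c by simp
  also have "\<dots> \<le> measure lborel ({0..<2 * pi} \<inter> arc a r)"
  proof (rule measure_mono_fmeasurable[OF sub])
    have "emeasure lborel ({0..<2 * pi} \<inter> arc a r) \<le> emeasure lborel {0..<2 * pi}"
      by (rule emeasure_mono) auto
    then show "{0..<2 * pi} \<inter> arc a r \<in> fmeasurable lborel"
      by (intro fmeasurableI) (auto simp: top_unique less_top[symmetric])
  qed auto
  finally show ?thesis
    unfolding mu_def by (subst measure_uniform_measure) auto
qed

text \<open>
  By continuity and periodicity, a point where \<open>\<theta>\<close> does not vanish has a whole arc of such points around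
  it, and arcs have positive measure.
\<close>

lemma circle_cont_AE_zero:
  assumes \<theta>: "\<theta> \<in> circle_cont" and ae: "AE x in mu. \<theta> x = 0"
  shows "\<theta> x = 0"
proof (rule ccontr)
  assume nz: "\<theta> x \<noteq> 0"
  have "isCont \<theta> x" and per: "periodic \<theta>" using \<theta> by (auto simp: circle_cont_def continuous_on_eq_continuous_at)
  then obtain r where r: "r > 0" "\<And>y. dist x y < r \<Longrightarrow> \<theta> y \<noteq> 0"
    using continuous_at_avoid[of x \<theta> 0] nz by blast
  have "\<theta> y \<noteq> 0" if y: "y \<in> arc x r" for y
  proof -
    obtain k :: int where k: "\<bar>y - x - 2 * pi * of_int k\<bar> < r"
      using y unfolding arc_def by blast
    then have "\<theta> (y - 2 * pi * of_int k) \<noteq> 0"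
      by (intro r(2)) (simp add: dist_real_def abs_minus_commute algebra_simps)
    then show ?thesis using periodic_shift_int[OF per, of "y - 2 * pi * of_int k" k] by simp
  qed
  then have "AE y in mu. y \<notin> arc x r"
    using ae by (auto elim!: eventually_mono)
  then have "measure mu (arc x r) = 0"
    by (subst (asm) AE_iff_measurable[OF _ refl]) (auto simp: measure_def)
  with measure_arc_pos[OF r(1), of x] show False by simp
qed

section \<open>Absolutely convergent Fourier series\<close>

lemma fourier_series_uniform_limit:
  assumes "(\<lambda>k. cmod (c k)) summable_on UNIV"
  shows "uniform_limit UNIV (\<lambda>X x. \<Sum>k\<in>X. c k * e k x) (\<lambda>x. \<Sum>\<^sub>\<infinity>k. c k * e k x) (finite_subsets_at_top UNIV)"
  using assms by (intro Weierstrass_m_test_general[where M="\<lambda>k. cmod (c k)"]) (auto simp: norm_mult)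

lemma fourier_series_circle_cont:
  assumes "(\<lambda>k. cmod (c k)) summable_on UNIV"
  shows "(\<lambda>x. \<Sum>\<^sub>\<infinity>k. c k * e k x) \<in> circle_cont"
proof -
  have "continuous_on UNIV (\<lambda>x. \<Sum>\<^sub>\<infinity>k. c k * e k x)"
    by (rule uniform_limit_theorem[OF _ fourier_series_uniform_limit[OF assms]])
      (auto intro!: always_eventually continuous_intros)
  then show ?thesis by (simp add: circle_cont_def periodic_def e_periodic)
qed

lemma fourier_series_integral:
  assumes c: "(\<lambda>k. cmod (c k)) summable_on UNIV" and M: "finite_measure M" "sets M = sets borel"
  shows "((\<lambda>k. c k * (\<integral>x. e k x \<partial>M)) has_sum (\<integral>x. (\<Sum>\<^sub>\<infinity>k. c k * e k x) \<partial>M)) UNIV"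
  unfolding has_sum_def
proof (rule tendstoI)
  interpret M: finite_measure M by fact
  define \<psi> where "\<psi> x = (\<Sum>\<^sub>\<infinity>k. c k * e k x)" for x
  have \<psi>: "\<psi> \<in> circle_cont" unfolding \<psi>_def[abs_def] by (rule fourier_series_circle_cont[OF c])
  fix \<eta> :: real assume \<eta>: "\<eta> > 0"
  define K where "K = measure M (space M) + 1"
  have K: "K > 0" by (simp add: K_def add_nonneg_pos)
  have e_cont: "(\<lambda>x. c k * e k x) \<in> circle_cont" for k
    by (rule trig_poly_circle_cont[OF trig_poly.monomial])
  have int: "integrable M (\<lambda>x. c k * e k x)" "integrable M \<psi>" for k
    using e_cont \<psi> M by (auto intro: integrable_circle_cont)
  have "\<forall>\<^sub>F X in finite_subsets_at_top UNIV. \<forall>x\<in>UNIV. dist (\<Sum>k\<in>X. c k * e k x) (\<psi> x) < \<eta> / K"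
    using uniform_limitD[OF fourier_series_uniform_limit[OF c], of "\<eta> / K"] \<eta> K by (simp add: \<psi>_def)
  then show "\<forall>\<^sub>F X in finite_subsets_at_top UNIV. dist (\<Sum>k\<in>X. c k * (\<integral>x. e k x \<partial>M)) (\<integral>x. (\<Sum>\<^sub>\<infinity>k. c k * e k x) \<partial>M) < \<eta>"
    unfolding \<psi>_def[symmetric]
  proof eventually_elim
    case (elim X)
    have "(\<Sum>k\<in>X. c k * (\<integral>x. e k x \<partial>M)) - (\<integral>x. \<psi> x \<partial>M) = (\<integral>x. (\<Sum>k\<in>X. c k * e k x) - \<psi> x \<partial>M)"
      using int by (simp add: Bochner_Integration.integral_sum Bochner_Integration.integral_diff)
    also have "cmod \<dots> \<le> (\<integral>x. cmod ((\<Sum>k\<in>X. c k * e k x) - \<psi> x) \<partial>M)"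
      by (rule integral_norm_bound)
    also have "\<dots> \<le> (\<integral>x. \<eta> / K \<partial>M)"
      using elim int by (intro integral_mono integrable_norm Bochner_Integration.integrable_diff
        Bochner_Integration.integrable_sum) (auto simp: dist_norm intro: less_imp_le)
    also have "\<dots> = \<eta> * (measure M (space M) / K)" by simp
    also have "\<dots> < \<eta> * 1"
      using \<eta> K by (intro mult_strict_left_mono) (auto simp: K_def divide_simps)
    finally show ?case by (simp add: dist_norm)
  qed
qed

text \<open>
  The sum of the series is a continuous function with the same Fourier coefficients as \<open>\<phi>\<close>, so the two
  agree almost everywhere and, being continuous, everywhere.
\<close>

lemma fourier_series_eq:
  assumes \<phi>: "\<phi> \<in> circle_cont" and c: "(\<lambda>k. cmod (fourier_coeff \<phi> k)) summable_on UNIV"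
  shows "(\<Sum>\<^sub>\<infinity>k. fourier_coeff \<phi> k * e k x) = \<phi> x"
proof -
  define \<psi> where "\<psi> x = (\<Sum>\<^sub>\<infinity>k. fourier_coeff \<phi> k * e k x)" for x
  have \<psi>: "\<psi> \<in> circle_cont" unfolding \<psi>_def[abs_def] by (rule fourier_series_circle_cont[OF c])
  have coeff: "fourier_coeff \<psi> j = fourier_coeff \<phi> j" for j
  proof -
    have cj: "(\<lambda>k. cmod (fourier_coeff \<phi> (k + j))) summable_on UNIV"
      using c by (simp add: summable_on_shift_int[of "\<lambda>k. cmod (fourier_coeff \<phi> k)"])
    have "e (- j) x * \<psi> x = (\<Sum>\<^sub>\<infinity>k. fourier_coeff \<phi> (k + j) * e k x)" for x
    proof -
      have "e (- j) x * \<psi> x = (\<Sum>\<^sub>\<infinity>k. fourier_coeff \<phi> k * e (k - j) x)"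
      proof -
        have "e (k - j) x = e (- j) x * e k x" for k by (simp add: e_add)
        then show ?thesis
          by (simp add: \<psi>_def infsum_cmult_right'[symmetric] mult_ac)
      qed
      also have "\<dots> = (\<Sum>\<^sub>\<infinity>k. fourier_coeff \<phi> (k + j) * e k x)"
        by (rule infsum_reindex_bij_witness[of _ "\<lambda>k. k + j" "\<lambda>k. k - j"]) auto
      finally show ?thesis .
    qed
    then have "((\<lambda>k. fourier_coeff \<phi> (k + j) * of_bool (k = 0)) has_sum fourier_coeff \<psi> j) UNIV"
      using fourier_series_integral[OF cj mu.finite_measure_axioms sets_mu]
      by (simp only: integral_e_mu fourier_coeff_def[of \<psi>])
    moreover have "((\<lambda>k. fourier_coeff \<phi> (k + j) * of_bool (k = 0)) has_sum fourier_coeff \<phi> j) UNIV"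
      by (rule has_sum_finite_neutralI[of "{0}"]) auto
    ultimately show ?thesis by (rule has_sum_unique)
  qed
  have "AE x in mu. \<psi> x - \<phi> x = 0"
  proof (rule fourier_coeff_unique)
    have int: "integrable mu (\<lambda>x. \<theta> x)" if "\<theta> \<in> circle_cont" for \<theta>
      using that mu.finite_measure_axioms sets_mu by (rule integrable_circle_cont)
    have int': "integrable mu (\<lambda>x. e k x * \<theta> x)" if "\<theta> \<in> circle_cont" for \<theta> k
      using trig_poly_circle_cont[OF trig_poly.monomial[of 1 k]]
      by (intro integrable_circle_cont_mult int that) simp
    show "integrable mu (\<lambda>x. \<psi> x - \<phi> x)" using int \<psi> \<phi> by simp
    show "fourier_coeff (\<lambda>x. \<psi> x - \<phi> x) k = 0" for k
      using coeff[of k] by (simp add: fourier_coeff_def right_diff_distrib int' \<psi> \<phi>)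
  qed
  then have "\<psi> x - \<phi> x = 0"
    by (rule circle_cont_AE_zero[OF circle_cont_diff[OF \<psi> \<phi>]])
  then show ?thesis by (simp add: \<psi>_def)
qed

lemma periodic_derivative:
  assumes per: "periodic F" and d: "\<And>x. (F has_vector_derivative F' x) (at x)"
  shows "periodic F'"
  unfolding periodic_def
proof
  fix x
  have "((\<lambda>y. y + 2 * pi) has_vector_derivative 1) (at x)"
    by (auto intro!: derivative_eq_intros)
  from vector_diff_chain_at[OF this d[of "x + 2 * pi"]]
  have "((\<lambda>y. F (y + 2 * pi)) has_vector_derivative F' (x + 2 * pi)) (at x)"
    by (simp add: o_def)
  then have "(F has_vector_derivative F' (x + 2 * pi)) (at x)"
    using per by (simp add: periodic_def)
  then show "F' (x + 2 * pi) = F' x"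
    using d[of x] by (rule vector_derivative_unique_at)
qed

lemma circle_cont_L2:
  assumes "\<phi> \<in> circle_cont"
  shows "\<phi> \<in> L2"
proof -
  obtain B where "B \<ge> 0" "\<And>x. cmod (\<phi> x) \<le> B"
    using circle_cont_bounded[OF assms] by blast
  then have "(\<lambda>x. \<phi> x * e 0 x) \<in> L2"
    using assms by (intro L2_mult_bounded[where B=B] e_in_L2 circle_cont_measurable) (auto simp: circle_cont_def)
  then show ?thesis by simp
qed

lemma fourier_coeff_derivative:
  assumes per: "periodic F" and d: "\<And>x. (F has_vector_derivative F' x) (at x)" and c: "continuous_on UNIV F'"
  shows "fourier_coeff F' k = \<i> * of_int k * fourier_coeff F k"
proof -
  have cF: "continuous_on UNIV F"
    using d by (auto simp: continuous_on_eq_continuous_at intro: has_vector_derivative_continuous)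
  define g where "g x = e (- k) x * F' x + (\<i> * of_int (- k) * e (- k) x) * F x" for x
  have "((\<lambda>x. e (- k) x * F x) has_vector_derivative g x) (at x)" for x
    unfolding g_def by (rule has_vector_derivative_mult[OF e_derivative d])
  moreover have "continuous_on UNIV g"
    unfolding g_def by (intro continuous_intros c cF)
  ultimately have "(\<integral>x. g x \<partial>mu) = (e (- k) (2 * pi) * F (2 * pi) - e (- k) 0 * F 0) / (2 * pi)"
    by (rule integral_mu_antiderivative)
  also have "\<dots> = 0"
    using per e_periodic[of "- k" 0] by (auto simp: periodic_def dest: spec[of _ 0])
  finally have "(\<integral>x. g x \<partial>mu) = 0" .
  moreover have "(\<integral>x. g x \<partial>mu) = fourier_coeff F' k + \<i> * of_int (- k) * fourier_coeff F k"
  proof -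
    have "periodic F'" by (rule periodic_derivative[OF per d])
    then have cc: "F' \<in> circle_cont" "F \<in> circle_cont"
      using c cF per by (auto simp: circle_cont_def)
    have int: "integrable mu (\<lambda>x. e (- k) x * \<theta> x)" if "\<theta> \<in> circle_cont" for \<theta>
      using trig_poly_circle_cont[OF trig_poly.monomial[of 1 "- k"]]
      by (intro integrable_circle_cont_mult integrable_circle_cont[OF that mu.finite_measure_axioms sets_mu]) simp
    show ?thesis
      using int cc by (simp add: g_def mult.assoc fourier_coeff_def del: of_int_minus)
  qed
  ultimately show ?thesis by (simp add: algebra_simps)
qed

lemma summable_on_inverse_square_int: "(\<lambda>k::int. 1 / (of_int k)\<^sup>2 :: real) summable_on UNIV"
proof -
  have nat: "(\<lambda>n::nat. 1 / (real n)\<^sup>2) summable_on UNIV"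
    by (subst summable_on_UNIV_nonneg_real_iff)
      (use inverse_power_summable[of 2, where 'a=real] in \<open>auto simp: inverse_eq_divide\<close>)
  have "(\<lambda>k::int. 1 / (of_int k)\<^sup>2 :: real) summable_on range int"
    using nat by (subst summable_on_reindex) (auto simp: o_def)
  moreover have "(\<lambda>k::int. 1 / (of_int k)\<^sup>2 :: real) summable_on range (\<lambda>n. - int n)"
    using nat by (subst summable_on_reindex) (auto simp: o_def inj_on_def)
  ultimately have "(\<lambda>k::int. 1 / (of_int k)\<^sup>2 :: real) summable_on (range int \<union> range (\<lambda>n. - int n))"
    by (rule summable_on_union)
  moreover have "range int \<union> range (\<lambda>n. - int n) = UNIV"
  proof -
    have "k \<in> range int \<union> range (\<lambda>n. - int n)" for k
      by (cases k rule: int_cases2) auto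
    then show ?thesis by blast
  qed
  ultimately show ?thesis by simp
qed

text \<open>
  The derivative has the square-summable coefficients \<open>\<i> k c\<^sub>k\<close>, and \<open>\<bar>c\<^sub>k\<bar> \<le> \<bar>k c\<^sub>k\<bar>\<^sup>2 + 1 / k\<^sup>2\<close> for
  \<open>k \<noteq> 0\<close>.
\<close>

lemma circle_smooth_fourier_coeff_summable:
  assumes "\<phi> \<in> circle_smooth"
  shows "(\<lambda>k. cmod (fourier_coeff \<phi> k)) summable_on UNIV"
proof -
  obtain D where D0: "D 0 = \<phi>" and D: "\<And>n x. (D n has_vector_derivative D (Suc n) x) (at x)"
    and per: "periodic \<phi>"
    using assms by (auto simp: circle_smooth_def)
  have cont: "continuous_on UNIV (D n)" for n
    using D by (auto simp: continuous_on_eq_continuous_at intro: has_vector_derivative_continuous)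
  have "D 1 \<in> circle_cont"
    using periodic_derivative[OF per D[of 0, unfolded D0]] cont[of 1] by (simp add: circle_cont_def)
  then have "(\<lambda>k. (cmod (fourier_coeff (D 1) k))\<^sup>2) summable_on UNIV"
    by (intro Bessel_summable circle_cont_L2)
  moreover have "fourier_coeff (D 1) k = \<i> * of_int k * fourier_coeff \<phi> k" for k
    using fourier_coeff_derivative[OF per D[of 0, unfolded D0]] cont[of 1] by simp
  ultimately have B: "(\<lambda>k. (\<bar>of_int k\<bar> * cmod (fourier_coeff \<phi> k))\<^sup>2) summable_on UNIV"
    by (simp add: norm_mult)
  have z: "(\<lambda>k. if k = 0 then cmod (fourier_coeff \<phi> 0) else 0) summable_on UNIV"
    by (rule finite_nonzero_values_imp_summable_on) simp
  show ?thesis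
  proof (rule summable_on_comparison_test[OF summable_on_add[OF summable_on_add[OF B summable_on_inverse_square_int] z]])
    fix k
    show "cmod (fourier_coeff \<phi> k) \<le> (\<bar>of_int k\<bar> * cmod (fourier_coeff \<phi> k))\<^sup>2 + 1 / (of_int k)\<^sup>2
        + (if k = 0 then cmod (fourier_coeff \<phi> 0) else 0)"
    proof (cases "k = 0")
      case False
      define A t where "A = \<bar>of_int k\<bar> * cmod (fourier_coeff \<phi> k)" and "t = 1 / \<bar>real_of_int k\<bar>"
      have "cmod (fourier_coeff \<phi> k) = A * t" using False by (simp add: A_def t_def)
      also have "\<dots> \<le> A\<^sup>2 + t\<^sup>2"
      proof -
        have "0 \<le> A * t" by (simp add: A_def t_def)
        with sum_squares_bound[of A t] show ?thesis by linarith
      qed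
      also have "t\<^sup>2 = 1 / (of_int k)\<^sup>2" by (simp add: t_def power_divide)
      finally show ?thesis using False by (simp add: A_def)
    qed simp
  qed simp
qed

section \<open>Concentrated functions under convolution, and the limit measure\<close>

lemma cmod_cis_diff_le: "cmod (cis s - cis t) \<le> \<bar>s - t\<bar>"
proof -
  have "cis s - cis t = cis t * (exp (\<i> * complex_of_real (s - t)) - 1)"
    unfolding cis_conv_exp[symmetric] by (simp add: right_diff_distrib cis_mult)
  then have "cmod (cis s - cis t) = 2 * \<bar>sin ((s - t) / 2)\<bar>"
    by (simp only: norm_mult dist_exp_i_1) simp
  also have "\<dots> \<le> 2 * \<bar>(s - t) / 2\<bar>"
    by (intro mult_left_mono abs_sin_x_le_abs_x) simp
  finally show ?thesis by simp
qed

lemma e_diff_on_arc: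
  assumes "x \<in> arc a r"
  shows "cmod (e m x - e m a) \<le> \<bar>of_int m\<bar> * r"
proof -
  obtain k :: int where k: "\<bar>x - a - 2 * pi * of_int k\<bar> < r"
    using assms unfolding arc_def by blast
  define y where "y = x - 2 * pi * of_int k"
  have "e m x = e m y"
    using periodic_shift_int[OF periodic_e, of m y k] by (simp add: y_def)
  then have "cmod (e m x - e m a) = cmod (cis (of_int m * y) - cis (of_int m * a))"
    by (simp add: e_def)
  also have "\<dots> \<le> \<bar>of_int m * y - of_int m * a\<bar>" by (rule cmod_cis_diff_le)
  also have "\<dots> = \<bar>of_int m\<bar> * \<bar>y - a\<bar>" by (simp add: abs_mult right_diff_distrib[symmetric])
  also have "\<dots> \<le> \<bar>of_int m\<bar> * r"
    using k by (intro mult_left_mono) (auto simp: y_def)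
  finally show ?thesis .
qed

text \<open>
  The defect sequence consists of the Fourier coefficients of \<open>(e (- m) - e (- m) a) f\<close>. On the support of
  \<open>f\<close> the first factor is at most \<open>\<bar>m\<bar> \<epsilon>\<close>, so the Bessel inequality bounds the defect.
\<close>

lemma concentrated_coefficients_of_arc:
  assumes f: "f \<in> L2" "AE x in mu. f x = restr (arc a \<epsilon>) f x" "(L2_norm f)\<^sup>2 = 1" and eps: "\<epsilon> > 0"
  shows "concentrated_coefficients (fourier_coeff f) (\<lambda>m. e (- m) a) \<epsilon>"
proof
  show "((\<lambda>k. (cmod (fourier_coeff f k))\<^sup>2) has_sum 1) UNIV"
    using Parseval[OF f(1)] f(3) by simp
  fix m :: int
  define h where "h x = (e (- m) x - e (- m) a) * f x" for x
  have h: "h \<in> L2"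
    using L2_diff[OF L2_e_mult[OF f(1), of "- m"] L2_cmult[OF f(1), of "e (- m) a"]]
    by (simp add: h_def[abs_def] left_diff_distrib)
  have coeff: "fourier_coeff h k = fourier_coeff f (k + m) - e (- m) a * fourier_coeff f k" for k
    using fourier_coeff_diff[OF L2_e_mult[OF f(1), of "- m"] L2_cmult[OF f(1), of "e (- m) a"], of k]
    by (simp add: h_def[abs_def] left_diff_distrib fourier_coeff_e_mult fourier_coeff_cmult)
  show "(\<lambda>k. (cmod (fourier_coeff f (k + m) - e (- m) a * fourier_coeff f k))\<^sup>2) summable_on UNIV"
    using Bessel_summable[OF h] by (simp add: coeff)
  have "(L2_norm h)\<^sup>2 \<le> (\<integral>x. (of_int m * \<epsilon>)\<^sup>2 * (cmod (f x))\<^sup>2 \<partial>mu)"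
    unfolding L2_norm_square
  proof (rule integral_mono_AE)
    show "AE x in mu. (cmod (h x))\<^sup>2 \<le> (of_int m * \<epsilon>)\<^sup>2 * (cmod (f x))\<^sup>2"
      using f(2)
    proof eventually_elim
      case (elim x)
      show ?case
      proof (cases "x \<in> arc a \<epsilon>")
        case True
        have "cmod (h x) \<le> (\<bar>of_int m\<bar> * \<epsilon>) * cmod (f x)"
          unfolding h_def norm_mult using e_diff_on_arc[OF True, of "- m"] by (intro mult_right_mono) auto
        then have "(cmod (h x))\<^sup>2 \<le> ((\<bar>of_int m\<bar> * \<epsilon>) * cmod (f x))\<^sup>2"
          by (intro power_mono) auto
        then show ?thesis by (simp add: power_mult_distrib)
      next
        case False
        then have "f x = 0" using elim by (simp add: restr_def)
        then show ?thesis by (simp add: h_def)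
      qed
    qed
  qed (use L2_integrable_square[OF h] L2_integrable_square[OF f(1)] in auto)
  also have "\<dots> = (of_int m * \<epsilon>)\<^sup>2"
    using f(3) by (simp add: L2_norm_square)
  finally show "(\<Sum>\<^sub>\<infinity>k. (cmod (fourier_coeff f (k + m) - e (- m) a * fourier_coeff f k))\<^sup>2) \<le> (of_int m * \<epsilon>)\<^sup>2"
    using Bessel_infsum[OF h] by (simp add: coeff)
qed (use eps in auto)

text \<open>
  The coefficients are square summable because the \<open>w_coeff W k a\<close> are bounded; so the choice in the
  definition of \<open>L_conv\<close> succeeds by the Riesz--Fischer theorem.
\<close>

lemma L_conv_fourier_series:
  assumes W: "diagonal_type W" and f: "f \<in> L2"
  shows "L2_fourier_series (\<lambda>k. w_coeff W k a * fourier_coeff f k) (L_conv W a f)"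
proof -
  have "(\<lambda>k. (cmod (w_coeff W k a * fourier_coeff f k))\<^sup>2) summable_on UNIV"
  proof (rule summable_on_comparison_test)
    show "(\<lambda>k. (DT_norm W)\<^sup>2 * (cmod (fourier_coeff f k))\<^sup>2) summable_on UNIV"
      by (rule summable_on_cmult_right[OF Bessel_summable[OF f]])
    show "(cmod (w_coeff W k a * fourier_coeff f k))\<^sup>2 \<le> (DT_norm W)\<^sup>2 * (cmod (fourier_coeff f k))\<^sup>2" for k
      unfolding norm_mult power_mult_distrib
      by (intro mult_right_mono power_mono w_coeff_bound W) auto
  qed simp
  from Riesz_Fischer[OF this] show ?thesis
    unfolding L_conv_def by (rule someI_ex)
qed

lemma L_conv_L2: "diagonal_type W \<Longrightarrow> f \<in> L2 \<Longrightarrow> L_conv W a f \<in> L2"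
  using L_conv_fourier_series[of W f a] by (simp add: L2_fourier_series_def)

text \<open>
  Parseval for \<open>g = L_conv W a f\<close> and \<open>e m * g\<close>, whose coefficients are those of \<open>g\<close> shifted by \<open>m\<close>.
\<close>

lemma L_conv_square_coeff_has_sum:
  assumes W: "diagonal_type W" and f: "f \<in> L2"
  shows "((\<lambda>k. (w_coeff W (k + m) a * cnj (w_coeff W k a)) * (fourier_coeff f (k + m) * cnj (fourier_coeff f k)))
    has_sum (\<integral>x. e (- m) x * complex_of_real ((cmod (L_conv W a f x))\<^sup>2) \<partial>mu)) UNIV"
proof -
  define c where "c k = w_coeff W k a * fourier_coeff f k" for k
  define g where "g = L_conv W a f"
  have g: "L2_fourier_series c g"
    using L_conv_fourier_series[OF W f] by (simp add: c_def[abs_def] g_def)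
  have gL: "g \<in> L2" using g by (simp add: L2_fourier_series_def)
  have "((\<lambda>k. c k * cnj (fourier_coeff (\<lambda>x. e m x * g x) k)) has_sum (\<integral>x. g x * cnj (e m x * g x) \<partial>mu)) UNIV"
    by (rule Parseval_inner[OF g L2_e_mult[OF gL]])
  moreover have "fourier_coeff (\<lambda>x. e m x * g x) k = c (k - m)" for k
    by (simp add: fourier_coeff_e_mult L2_fourier_series_coeff[OF g])
  moreover have "g x * cnj (e m x * g x) = e (- m) x * complex_of_real ((cmod (g x))\<^sup>2)" for x
    unfolding cmod_square_eq by (simp add: cnj_e mult_ac)
  ultimately have "((\<lambda>k. c k * cnj (c (k - m))) has_sum (\<integral>x. e (- m) x * complex_of_real ((cmod (g x))\<^sup>2) \<partial>mu)) UNIV"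
    by (simp only:)
  then have "((\<lambda>k. c (k + m) * cnj (c (k + m - m))) has_sum (\<integral>x. e (- m) x * complex_of_real ((cmod (g x))\<^sup>2) \<partial>mu)) UNIV"
    by (subst has_sum_shift_int[of "\<lambda>k. c k * cnj (c (k - m))"])
  moreover have "c (k + m) * cnj (c (k + m - m))
      = (w_coeff W (k + m) a * cnj (w_coeff W k a)) * (fourier_coeff f (k + m) * cnj (fourier_coeff f k))" for k
    by (simp add: c_def mult_ac)
  ultimately show ?thesis by (simp only: g_def)
qed

lemma w_coeff_product_bound:
  assumes W: "diagonal_type W"
  shows "cmod (w_coeff W (k + m) a * cnj (w_coeff W k a)) \<le> (DT_norm W)\<^sup>2"
  unfolding norm_mult complex_mod_cnj power2_eq_square
  by (intro mult_mono w_coeff_bound W DT_norm_nonneg norm_ge_zero)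

lemma v_coeff_bound:
  assumes "regular_operator W"
  shows "cmod (v_coeff W m a) \<le> (DT_norm W)\<^sup>2"
proof (rule tendsto_upperbound[OF tendsto_norm[OF w_coeff_product_mean[OF assms]] _ long_intervals_nontrivial])
  have W: "diagonal_type W" using assms by (simp add: regular_operator_def)
  have "cmod ((\<Sum>l\<in>I. w_coeff W (l + m) a * cnj (w_coeff W l a)) / of_nat (card I)) \<le> (DT_norm W)\<^sup>2" for I
  proof (cases "card I = 0")
    case False
    have "cmod (\<Sum>l\<in>I. w_coeff W (l + m) a * cnj (w_coeff W l a)) \<le> of_nat (card I) * (DT_norm W)\<^sup>2"
      by (intro sum_norm_bound w_coeff_product_bound W)
    then show ?thesis
      using False by (simp add: norm_divide divide_simps mult.commute)
  qed simp
  then show "\<forall>\<^sub>F I in long_intervals. cmod ((\<Sum>l\<in>I. w_coeff W (l + m) a * cnj (w_coeff W l a)) / of_nat (card I)) \<le> (DT_norm W)\<^sup>2"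
    by (rule always_eventually[OF allI])
qed

text \<open>
  Convergence along \<open>long_intervals\<close> is uniform in the position: one length \<open>N\<close> serves all windows.
\<close>

lemma w_coeff_product_window:
  assumes W: "regular_operator W" and \<delta>: "\<delta> > 0"
  obtains N :: nat where "N > 0"
    "\<And>k. cmod ((\<Sum>j<N. w_coeff W (k + int j + m) a * cnj (w_coeff W (k + int j) a)) / of_nat N - v_coeff W m a) \<le> \<delta>"
proof -
  define G where "G l = w_coeff W (l + m) a * cnj (w_coeff W l a)" for l
  have "\<forall>\<^sub>F I in long_intervals. dist ((\<Sum>l\<in>I. G l) / of_nat (card I)) (v_coeff W m a) < \<delta>"
    using tendstoD[OF w_coeff_product_mean[OF W] \<delta>] by (simp add: G_def)
  then obtain N0 where N0: "\<And>p q. card {p..q::int} \<ge> N0 \<Longrightarrow>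
      dist ((\<Sum>l\<in>{p..q}. G l) / of_nat (card {p..q})) (v_coeff W m a) < \<delta>"
    unfolding eventually_long_intervals by blast
  \<comment> \<open>A window must not be empty.\<close>
  define N where "N = max N0 1"
  have "cmod ((\<Sum>j<N. G (k + int j)) / of_nat N - v_coeff W m a) \<le> \<delta>" for k
  proof -
    have "(\<Sum>l\<in>{k..k + int N - 1}. G l) = (\<Sum>j<N. G (k + int j))"
      by (rule sum.reindex_bij_witness[of _ "\<lambda>j. k + int j" "\<lambda>l. nat (l - k)"]) auto
    then show ?thesis
      using N0[of k "k + int N - 1"] by (simp add: N_def dist_norm less_imp_le)
  qed
  then show ?thesis using that[of N] by (simp add: G_def N_def)
qed

lemma concentrated_square_coeff_estimate:
  assumes W: "diagonal_type W"
    and f: "f \<in> L2" "AE x in mu. f x = restr (arc a \<epsilon>) f x" "(L2_norm f)\<^sup>2 = 1" and eps: "\<epsilon> > 0"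
    and N: "N > 0"
    and window: "\<And>k. cmod ((\<Sum>j<N. w_coeff W (k + int j + m) a * cnj (w_coeff W (k + int j) a)) / of_nat N - v) \<le> \<delta>"
  shows "cmod ((\<integral>x. e (- m) x * complex_of_real ((cmod (L_conv W a f x))\<^sup>2) \<partial>mu) - e (- m) a * v)
    \<le> \<delta> + (DT_norm W)\<^sup>2 * ((real N)\<^sup>2 + (of_int m)\<^sup>2 + 2) * \<epsilon>"
proof -
  interpret concentrated_coefficients "fourier_coeff f" "\<lambda>m. e (- m) a" \<epsilon>
    by (rule concentrated_coefficients_of_arc[OF f eps])
  define G where "G k = w_coeff W (k + m) a * cnj (w_coeff W k a)" for k
  define S where "S = (\<Sum>\<^sub>\<infinity>k. G k * complex_of_real ((cmod (fourier_coeff f k))\<^sup>2))"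
  define I where "I = (\<integral>x. e (- m) x * complex_of_real ((cmod (L_conv W a f x))\<^sup>2) \<partial>mu)"
  have G: "cmod (G k) \<le> (DT_norm W)\<^sup>2" for k
    unfolding G_def by (rule w_coeff_product_bound[OF W])
  have "cmod (S - v) \<le> \<delta> + (DT_norm W)\<^sup>2 * ((real N)\<^sup>2 + 1) * \<epsilon>"
    unfolding S_def by (rule weighted_average[OF G N]) (use window in \<open>simp add: G_def\<close>)
  moreover have "cmod (I - e (- m) a * S) \<le> (DT_norm W)\<^sup>2 * ((of_int m)\<^sup>2 + 1) * \<epsilon>"
    unfolding S_def I_def
    by (rule weighted_correlation[OF G]) (unfold G_def, rule L_conv_square_coeff_has_sum[OF W f(1)])
  moreover have "cmod (I - e (- m) a * v) \<le> cmod (I - e (- m) a * S) + cmod (S - v)"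
  proof -
    have "I - e (- m) a * v = (I - e (- m) a * S) + e (- m) a * (S - v)"
      by (simp add: right_diff_distrib)
    also have "cmod \<dots> \<le> cmod (I - e (- m) a * S) + cmod (e (- m) a * (S - v))"
      by (rule norm_triangle_ineq)
    finally show ?thesis by (simp add: norm_mult)
  qed
  ultimately have "cmod (I - e (- m) a * v)
      \<le> (DT_norm W)\<^sup>2 * ((of_int m)\<^sup>2 + 1) * \<epsilon> + (\<delta> + (DT_norm W)\<^sup>2 * ((real N)\<^sup>2 + 1) * \<epsilon>)"
    by linarith
  then show ?thesis
    unfolding I_def[symmetric] by (simp add: algebra_simps)
qed

text \<open>
  Given \<open>\<eta>\<close>, first fix the window length \<open>N\<close> such that all window averages are within \<open>\<eta> / 2\<close>
  of the mean value; then the remaining error is a constant depending on \<open>N\<close> times \<open>\<epsilon>\<close>.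
\<close>

theorem concentrating_coeff_tendsto:
  assumes W: "regular_operator W" and f: "concentrating a f"
  shows "((\<lambda>\<epsilon>. \<integral>x. e (- m) x * complex_of_real ((cmod (L_conv W a (f \<epsilon>) x))\<^sup>2) \<partial>mu)
    \<longlongrightarrow> e (- m) a * v_coeff W m a) (at_right 0)"
proof (rule tendstoI)
  have dt: "diagonal_type W" using W by (simp add: regular_operator_def)
  fix \<eta> :: real assume \<eta>: "\<eta> > 0"
  then have "\<eta> / 2 > 0" by simp
  from w_coeff_product_window[OF W this] obtain N where N: "N > 0" and
    window: "\<And>k. cmod ((\<Sum>j<N. w_coeff W (k + int j + m) a * cnj (w_coeff W (k + int j) a)) / of_nat N - v_coeff W m a) \<le> \<eta> / 2"
    by blast
  define K where "K = (DT_norm W)\<^sup>2 * ((real N)\<^sup>2 + (of_int m)\<^sup>2 + 2)"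
  have "((\<lambda>\<epsilon>. K * \<epsilon>) \<longlongrightarrow> K * 0) (at_right 0)" by (intro tendsto_intros)
  then have "\<forall>\<^sub>F \<epsilon> in at_right 0. K * \<epsilon> < \<eta> / 2"
    by (rule order_tendstoD) (use \<eta> in simp)
  then show "\<forall>\<^sub>F \<epsilon> in at_right 0. dist (\<integral>x. e (- m) x * complex_of_real ((cmod (L_conv W a (f \<epsilon>) x))\<^sup>2) \<partial>mu)
      (e (- m) a * v_coeff W m a) < \<eta>"
    using f[unfolded concentrating_def] eventually_at_right_less[of "0::real"]
  proof eventually_elim
    case (elim \<epsilon>)
    then have "cmod ((\<integral>x. e (- m) x * complex_of_real ((cmod (L_conv W a (f \<epsilon>) x))\<^sup>2) \<partial>mu) - e (- m) a * v_coeff W m a)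
        \<le> \<eta> / 2 + K * \<epsilon>"
      unfolding K_def by (intro concentrated_square_coeff_estimate dt N window) auto
    with elim show ?case by (simp add: dist_norm)
  qed
qed

text \<open>
  Admissible families exist; one of them is needed to produce the limit measure.
\<close>

lemma concentrating_indicator:
  "concentrating a (\<lambda>\<epsilon> x. indicator (arc a \<epsilon>) x / complex_of_real (sqrt (measure mu (arc a \<epsilon>))))"
  unfolding concentrating_def
proof (rule eventually_mono[OF eventually_at_right_less])
  fix \<epsilon> :: real assume eps: "0 < \<epsilon>"
  define t where "t = measure mu (arc a \<epsilon>)"
  have t: "t > 0" unfolding t_def by (rule measure_arc_pos[OF eps])
  define f where "f x = indicator (arc a \<epsilon>) x / complex_of_real (sqrt t)" for x
  have sq: "(cmod (f x))\<^sup>2 = indicator (arc a \<epsilon>) x / t" for x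
    using t by (simp add: f_def norm_divide power_divide indicator_def)
  have "f \<in> L2"
  proof -
    have "integrable mu (\<lambda>x. indicator (arc a \<epsilon>) x / t)"
      by (intro integrable_divide_zero integrable_real_indicator) (auto simp: mu.emeasure_eq_measure)
    then show ?thesis
      unfolding L2_def by (simp add: sq) (simp add: f_def[abs_def] periodic_def indicator_def arc_periodic)
  qed
  moreover have "f x = restr (arc a \<epsilon>) f x" for x
    by (simp add: f_def restr_def indicator_def)
  moreover have "(L2_norm f)\<^sup>2 = 1"
    unfolding L2_norm_square sq using t by (simp add: t_def)
  ultimately show "f \<in> L2 \<and> (AE x in mu. f x = restr (arc a \<epsilon>) f x) \<and> (L2_norm f)\<^sup>2 = 1"
    by simp
qed

text \<open>
  For a non-negative measure the supremum is attained at the constant function \<open>1\<close>.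
\<close>

lemma C_dual_norm_measure:
  assumes M: "finite_measure M" "sets M = sets borel"
  shows "C_dual_norm (\<lambda>\<phi>. \<integral>x. \<phi> x \<partial>M) = emeasure M (space M)"
proof -
  interpret M: finite_measure M by fact
  show ?thesis
    unfolding C_dual_norm_def
  proof (rule antisym)
    show "(SUP \<phi>\<in>{\<phi> \<in> circle_cont. \<forall>x. cmod (\<phi> x) \<le> 1}. ennreal (cmod (\<integral>x. \<phi> x \<partial>M))) \<le> emeasure M (space M)"
    proof (rule SUP_least)
      fix \<phi> assume "\<phi> \<in> {\<phi> \<in> circle_cont. \<forall>x. cmod (\<phi> x) \<le> 1}"
      then have \<phi>: "\<phi> \<in> circle_cont" "\<And>x. cmod (\<phi> x) \<le> 1" by auto
      have "cmod (\<integral>x. \<phi> x \<partial>M) \<le> (\<integral>x. cmod (\<phi> x) \<partial>M)" by (rule integral_norm_bound)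
      also have "\<dots> \<le> (\<integral>x. 1 \<partial>M)"
        using \<phi> by (intro integral_mono integrable_norm integrable_circle_cont[OF _ M]) auto
      finally show "ennreal (cmod (\<integral>x. \<phi> x \<partial>M)) \<le> emeasure M (space M)"
        by (simp add: M.emeasure_eq_measure)
    qed
    have "(\<lambda>x. 1) \<in> {\<phi> \<in> circle_cont. \<forall>x. cmod (\<phi> x) \<le> 1}"
      using trig_poly_circle_cont[OF trig_poly_const[of 1]] by simp
    then have "ennreal (cmod (\<integral>x. 1 \<partial>M)) \<le> (SUP \<phi>\<in>{\<phi> \<in> circle_cont. \<forall>x. cmod (\<phi> x) \<le> 1}. ennreal (cmod (\<integral>x. \<phi> x \<partial>M)))"
      by (rule SUP_upper)
    then show "emeasure M (space M) \<le> (SUP \<phi>\<in>{\<phi> \<in> circle_cont. \<forall>x. cmod (\<phi> x) \<le> 1}. ennreal (cmod (\<integral>x. \<phi> x \<partial>M)))"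
      by (simp add: M.emeasure_eq_measure)
  qed
qed

text \<open>
  Integrate the absolutely convergent Fourier series of the test function term by term; the \<open>k\<close>-th term
  of that series pairs with the term \<open>m = - k\<close> of the series for \<open>\<nu>\<close>.
\<close>

lemma is_nu_of_coefficients:
  assumes M: "finite_measure M" "sets M = sets borel"
    and coeff: "\<And>m. (\<integral>x. e (- m) x \<partial>M) = e (- m) a * v_coeff W m a"
  shows "is_nu W a M"
  unfolding is_nu_def
proof
  fix \<phi> assume \<phi>: "\<phi> \<in> circle_smooth"
  have cont: "\<phi> \<in> circle_cont"
    using \<phi> by (auto simp: circle_smooth_def circle_cont_def continuous_on_eq_continuous_at
      intro: has_vector_derivative_continuous)
  have c: "(\<lambda>k. cmod (fourier_coeff \<phi> k)) summable_on UNIV"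
    by (rule circle_smooth_fourier_coeff_summable[OF \<phi>])
  have "((\<lambda>k. fourier_coeff \<phi> k * (\<integral>x. e k x \<partial>M)) has_sum (\<integral>x. \<phi> x \<partial>M)) UNIV"
    using fourier_series_integral[OF c M] by (simp add: fourier_series_eq[OF cont c])
  then have "((\<lambda>m. fourier_coeff \<phi> (0 - m) * (\<integral>x. e (0 - m) x \<partial>M)) has_sum (\<integral>x. \<phi> x \<partial>M)) UNIV"
    by (subst has_sum_reflect_int[of "\<lambda>k. fourier_coeff \<phi> k * (\<integral>x. e k x \<partial>M)"])
  moreover have "fourier_coeff \<phi> (0 - m) * (\<integral>x. e (0 - m) x \<partial>M) = (\<integral>x. \<phi> x * (v_coeff W m a * e m (x - a)) \<partial>mu)" for m
  proof -
    have "(\<integral>x. \<phi> x * (v_coeff W m a * e m (x - a)) \<partial>mu) = (\<integral>x. (e (- m) a * v_coeff W m a) * (e m x * \<phi> x) \<partial>mu)"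
      by (simp add: e_diff mult_ac)
    also have "\<dots> = (e (- m) a * v_coeff W m a) * fourier_coeff \<phi> (- m)"
      by (simp add: fourier_coeff_def)
    finally show ?thesis by (simp add: coeff)
  qed
  ultimately show "((\<lambda>m. \<integral>x. \<phi> x * (v_coeff W m a * e m (x - a)) \<partial>mu) has_sum (\<integral>x. \<phi> x \<partial>M)) UNIV"
    by (simp only:)
qed

lemma limit_measure_exists:
  assumes W: "regular_operator W"
  shows "\<exists>M. circle_measure M \<and> (\<forall>m. (\<integral>x. e (- m) x \<partial>M) = e (- m) a * v_coeff W m a)"
proof -
  have dt: "diagonal_type W" using W by (simp add: regular_operator_def)
  define f where "f \<epsilon> x = indicator (arc a \<epsilon>) x / complex_of_real (sqrt (measure mu (arc a \<epsilon>)))" for \<epsilon> x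
  have f: "concentrating a f" using concentrating_indicator[of a] by (simp add: f_def[abs_def])
  then obtain b where b: "b > 0" "\<And>\<epsilon>. 0 < \<epsilon> \<Longrightarrow> \<epsilon> < b \<Longrightarrow> f \<epsilon> \<in> L2"
    unfolding concentrating_def eventually_at_right_field by blast
  \<comment> \<open>The shift by \<open>2\<close> keeps the radii strictly below \<open>b\<close>, where all members of the family lie in \<open>L2\<close>.\<close>
  define s where "s n = b / real (n + 2)" for n
  have s: "0 < s n" "s n < b" for n
    using b(1) by (auto simp: s_def divide_simps)
  have "s \<longlonglongrightarrow> 0"
    unfolding s_def using LIMSEQ_ignore_initial_segment[OF lim_const_over_n[of b], of 2] by simp
  then have lim: "filterlim s (at_right 0) sequentially"
    unfolding filterlim_at using s(1) by (auto intro!: always_eventually simp: less_imp_neq[symmetric])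
  show ?thesis
  proof (rule measure_of_limit_coefficients)
    show "integrable mu (\<lambda>x. (cmod (L_conv W a (f (s n)) x))\<^sup>2)" for n
      by (rule L2_integrable_square[OF L_conv_L2[OF dt b(2)[OF s]]])
    show "(\<lambda>n. \<integral>x. e (- m) x * complex_of_real ((cmod (L_conv W a (f (s n)) x))\<^sup>2) \<partial>mu)
        \<longlonglongrightarrow> e (- m) a * v_coeff W m a" for m
      by (rule filterlim_compose[OF concentrating_coeff_tendsto[OF W f] lim])
  qed simp
qed

theorem lemma6p8:
  fixes W :: "(real \<Rightarrow> complex) \<Rightarrow> (real \<Rightarrow> complex)" and a :: real
  assumes "regular_operator W"
  shows "\<exists>M. circle_measure M \<and>
           is_nu W a M \<and>
           (\<forall>m. (\<integral>x. e (- m) x \<partial>M) = e (- m) a * v_coeff W m a) \<and>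
           (\<forall>f. concentrating a f \<longrightarrow>
              (\<forall>\<phi>\<in>circle_cont.
                 ((\<lambda>\<epsilon>. \<integral>x. \<phi> x * (cmod (L_conv W a (f \<epsilon>) x))\<^sup>2 \<partial>mu) \<longlongrightarrow> (\<integral>x. \<phi> x \<partial>M))
                   (at_right 0))) \<and>
           C_dual_norm (\<lambda>\<phi>. \<integral>x. \<phi> x \<partial>M) = emeasure M (space M) \<and>
           measure M (space M) \<le> (DT_norm W)\<^sup>2"
proof -
  have dt: "diagonal_type W" using assms by (simp add: regular_operator_def)
  obtain M where M: "circle_measure M" and coeff: "\<And>m. (\<integral>x. e (- m) x \<partial>M) = e (- m) a * v_coeff W m a"
    using limit_measure_exists[OF assms] by blast
  have fin: "finite_measure M" "sets M = sets borel" using M by (auto simp: circle_measure_def)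
  interpret M: finite_measure M by (rule fin)
  have weak: "((\<lambda>\<epsilon>. \<integral>x. \<phi> x * (cmod (L_conv W a (f \<epsilon>) x))\<^sup>2 \<partial>mu) \<longlongrightarrow> (\<integral>x. \<phi> x \<partial>M)) (at_right 0)"
    if f: "concentrating a f" and \<phi>: "\<phi> \<in> circle_cont" for f \<phi>
  proof -
    have "\<forall>\<^sub>F \<epsilon> in at_right 0. integrable mu (\<lambda>x. (cmod (L_conv W a (f \<epsilon>) x))\<^sup>2) \<and> (\<forall>x. 0 \<le> (cmod (L_conv W a (f \<epsilon>) x))\<^sup>2)"
      using f unfolding concentrating_def
      by (rule eventually_mono) (auto intro: L2_integrable_square L_conv_L2[OF dt])
    moreover have "((\<lambda>\<epsilon>. \<integral>x. e (- m) x * complex_of_real ((cmod (L_conv W a (f \<epsilon>) x))\<^sup>2) \<partial>mu)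
        \<longlongrightarrow> (\<integral>x. e (- m) x \<partial>M)) (at_right 0)" for m
      unfolding coeff by (rule concentrating_coeff_tendsto[OF assms f])
    ultimately show ?thesis
      using \<phi> by (rule weak_convergence_of_coefficients[OF fin])
  qed
  have "v_coeff W 0 a = complex_of_real (measure M (space M))"
    using coeff[of 0] by (simp add: scaleR_conv_of_real)
  then have "measure M (space M) \<le> (DT_norm W)\<^sup>2"
    using v_coeff_bound[OF assms, of 0 a] by simp
  with M coeff weak is_nu_of_coefficients[OF fin coeff] C_dual_norm_measure[OF fin]
  show ?thesis by blast
qed

end
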